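(* Let $\mathcal H$, $A$, $B$, $L$ be as in the context and let $(x_n)_{n\in\mathbb N}$ be generated by the stochastic forward-backward-forward algorithm described in the context, with auxiliary sequences $(w_n),(y_n),(r_n),(s_n)$, step sizes $(\lambda_n)$ and $\sigma$-algebras $\mathcal F_n=\sigma(x_{-1},x_0,r_0,x_1,r_1,\ldots,x_n,r_n)$. Then the following hold. (i) Assume that, for some real $\epsilon>0$, $(\lambda_n)_{n\in\mathbb N}$ is a sequence in $\left]\epsilon,\frac{1-\epsilon}{L}\right[$ and that $$\sum_{n\in\mathbb N}\mathsf E[\|s_n-By_n\|^2\,|\,\mathcal F_n]<+\infty\ \text{ a.s.}\quad\text{and}\quad \sum_{n\in\mathbb N}\|r_n-Bw_n\|^2<+\infty\ \text{ a.s.}$$ Then $(x_n)_{n\in\mathbb N}$ converges weakly a.s. to a random variable $\overline x$ with values in $(A+B)^{-1}(0)$. (ii) Suppose that $A$ or $B$ is uniformly monotone. Let $(\lambda_n)_{n\in\mathbb N}$ be a sequence in $\left]0,+\infty\right[$ such that $(\lambda_n)_{n\in\mathbb N}\in\ell_2(\mathbb N)\setminus\ell_1(\mathbb N)$ and $$\sum_{n\in\mathbb N}\lambda_n^2\|r_n-Bw_n\|^2<\infty\ \text{ a.s.}\quad\text{and}\quad \sum_{n\in\mathbb N}\lambda_n^2\,\mathsf E[\|s_n-By_n\|^2\,|\,\mathcal F_n]<+\infty\ \text{ a.s.}$$ Then $(x_n)_{n\in\mathbb N}$ converges strongly a.s. to the unique solution $\overline x$ of $0\in A\overline x+B\overline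 x$.
   Context: $\mathcal H$ is a separable real Hilbert space with inner product $\langle\cdot\mid\cdot\rangle$ and norm $\|\cdot\|$; all random variables are defined on a probability space $(\Omega,\mathcal F,\mathsf P)$, and $\mathsf E[\cdot\,|\,\cdot]$ denotes conditional expectation. Standing assumptions: $B:\mathcal H\to\mathcal H$ is monotone and $L$-Lipschitz continuous with $L>0$; $A:\mathcal H\to2^{\mathcal H}$ is maximally monotone; the solution set $(A+B)^{-1}(0)=\{x\in\mathcal H: 0\in Ax+Bx\}$ is nonempty. An operator $T:\mathcal H\to 2^{\mathcal H}$ is uniformly monotone if there is an increasing function $\phi:[0,\infty[\to[0,\infty]$ vanishing only at $0$ such that $\langle x-y\mid u-v\rangle\ge\phi(\|y-x\|)$ for all $u\in Tx$, $v\in Ty$. For $p\in\,]0,\infty[$, $\ell_p(\mathbb N)$ is the set of real sequences $(\lambda_n)_{n\in\mathbb N}$ with $\sum_{n}|\lambda_n|^p<+\infty$. Algorithm. Fix $\theta\in[0,1]$, a positive real sequence $(\lambda_n)_{n\in\mathbb N}$, and a sequence $(\epsilon_n)_{n\in\mathbb N}\subset[0,+\infty)$ with $\sum_{n=0}^{\infty}\epsilon_n<+\infty$. Let $x_{-1},x_0$ be $\mathcal H$-valued square integrable random variables. For each $n\ge0$: set $$\alpha_n=\min\Big\{\frac{\epsilon_n}{\|x_n-x_{n-1}\|},\theta\Big\}\ \text{if }x_n\ne x_{n-1},\qquad \alpha_n=\theta\ \text{if }x_n=x_{n-1};$$ let $r_n$ be an $\mathcal H$-valued random vector and set $$w_n=x_n+\alpha_n(x_n-x_{n-1}),\qquad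 y_n=(\mathrm{Id}+\lambda_nA)^{-1}(w_n-\lambda_nr_n);$$ let $s_n$ be an $\mathcal H$-valued random vector with $\mathsf E[s_n|\mathcal F_n]=By_n$, where $\mathcal F_n=\sigma(x_{-1},x_0,r_0,x_1,r_1,\ldots,x_n,r_n)$; and set $x_{n+1}=y_n-\lambda_n(s_n-r_n)$. *)

theory Defs
  imports "HOL-Probability.Probability"
begin

text \<open>A set-valued operator \<open>T : H \<rightarrow> 2\<^sup>H\<close> is a function of type \<open>'a \<Rightarrow> 'a set\<close>; a single-valued
  operator \<open>B\<close> is regarded as the set-valued operator \<open>\<lambda>x. {B x}\<close>.\<close>

definition op_add :: "('a::real_vector \<Rightarrow> 'a set) \<Rightarrow> ('a \<Rightarrow> 'a set) \<Rightarrow> 'a \<Rightarrow> 'a set" where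
  "op_add S T x = {u + v | u v. u \<in> S x \<and> v \<in> T x}"

definition op_scale :: "real \<Rightarrow> ('a::real_vector \<Rightarrow> 'a set) \<Rightarrow> 'a \<Rightarrow> 'a set" where
  "op_scale c T x = {c *\<^sub>R u | u. u \<in> T x}"

definition op_inv :: "('a \<Rightarrow> 'a set) \<Rightarrow> 'a \<Rightarrow> 'a set" where
  "op_inv T u = {x. u \<in> T x}"

definition resolvent :: "('a::real_vector \<Rightarrow> 'a set) \<Rightarrow> 'a \<Rightarrow> 'a set" where
  "resolvent T = op_inv (op_add (\<lambda>x. {x}) T)"

definition monotone_op :: "('a::real_inner \<Rightarrow> 'a set) \<Rightarrow> bool" where
  "monotone_op T \<longleftrightarrow> (\<forall>x y. \<forall>u\<in>T x. \<forall>v\<in>T y. inner (x - y) (u - v) \<ge> 0)"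

definition maximally_monotone_op :: "('a::real_inner \<Rightarrow> 'a set) \<Rightarrow> bool" where
  "maximally_monotone_op T \<longleftrightarrow>
     monotone_op T \<and> (\<forall>S. monotone_op S \<and> (\<forall>x. T x \<subseteq> S x) \<longrightarrow> S = T)"

text \<open>The modulus may take the value \<open>+\<infinity>\<close>; only its restriction to \<open>[0, \<infinity>[\<close> matters.
  ``Increasing'' is meant in the non-strict sense.\<close>

definition uniformly_monotone_op :: "('a::real_inner \<Rightarrow> 'a set) \<Rightarrow> bool" where
  "uniformly_monotone_op T \<longleftrightarrow>
     (\<exists>\<phi> :: real \<Rightarrow> ereal.
        mono_on {0..} \<phi> \<and> (\<forall>t\<ge>0. \<phi> t \<ge> 0) \<and> (\<forall>t\<ge>0. \<phi> t = 0 \<longleftrightarrow> t = 0) \<and>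
        (\<forall>x y. \<forall>u\<in>T x. \<forall>v\<in>T y. ereal (inner (x - y) (u - v)) \<ge> \<phi> (norm (y - x))))"

definition weakly_converges :: "(nat \<Rightarrow> 'a::real_inner) \<Rightarrow> 'a \<Rightarrow> bool" where
  "weakly_converges f l \<longleftrightarrow> (\<forall>v. (\<lambda>n. inner (f n) v) \<longlonglongrightarrow> inner l v)"

definition ell :: "real \<Rightarrow> (nat \<Rightarrow> real) set" where
  "ell p = {f. summable (\<lambda>n. \<bar>f n\<bar> powr p)}"

definition sigma_of :: "'w measure \<Rightarrow> ('w \<Rightarrow> 'a::topological_space) set \<Rightarrow> 'w measure" where
  "sigma_of M X = sigma (space M) (\<Union>f\<in>X. {f -` S \<inter> space M | S. S \<in> sets borel})"

text \<open>\<open>is_cond_exp M F f g\<close>: \<open>g\<close> is a version of the conditional expectation \<open>E[f | F]\<close> of the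
  integrable vector-valued \<open>f\<close>. The library's conditional expectations
  \<^const>\<open>nn_cond_exp\<close> and \<^const>\<open>real_cond_exp\<close> only cover scalar functions.\<close>

definition is_cond_exp ::
  "'w measure \<Rightarrow> 'w measure \<Rightarrow> ('w \<Rightarrow> 'a::{banach, second_countable_topology}) \<Rightarrow> ('w \<Rightarrow> 'a) \<Rightarrow> bool"
where
  "is_cond_exp M F f g \<longleftrightarrow>
     integrable M f \<and> integrable M g \<and> g \<in> borel_measurable F \<and>
     (\<forall>S\<in>sets F. set_lebesgue_integral M S g = set_lebesgue_integral M S f)"

text \<open>The inertial stochastic forward-backward-forward iteration. The sequence \<open>x\<close> is indexed by
  integers because the iteration starts from \<open>x\<^sub>-\<^sub>1\<close> and \<open>x\<^sub>0\<close>; indices below \<open>-1\<close> are irrelevant.\<close>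

definition inertia ::
  "real \<Rightarrow> (nat \<Rightarrow> real) \<Rightarrow> (int \<Rightarrow> 'w \<Rightarrow> 'a::real_normed_vector) \<Rightarrow> nat \<Rightarrow> 'w \<Rightarrow> real"
where
  "inertia \<theta> eps x n \<omega> =
     (if x (int n) \<omega> \<noteq> x (int n - 1) \<omega>
      then min (eps n / norm (x (int n) \<omega> - x (int n - 1) \<omega>)) \<theta> else \<theta>)"

definition history ::
  "'w measure \<Rightarrow> (int \<Rightarrow> 'w \<Rightarrow> 'a::topological_space) \<Rightarrow> (nat \<Rightarrow> 'w \<Rightarrow> 'a) \<Rightarrow> nat \<Rightarrow> 'w measure"
where
  "history M x r n = sigma_of M (x ` {-1..int n} \<union> r ` {..n})"

definition sfbf ::
  "'w measure \<Rightarrow> ('a::{real_inner, banach, second_countable_topology} \<Rightarrow> 'a set) \<Rightarrow> ('a \<Rightarrow> 'a) \<Rightarrow>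
   real \<Rightarrow> (nat \<Rightarrow> real) \<Rightarrow> (nat \<Rightarrow> real) \<Rightarrow> (int \<Rightarrow> 'w \<Rightarrow> 'a) \<Rightarrow>
   (nat \<Rightarrow> 'w \<Rightarrow> 'a) \<Rightarrow> (nat \<Rightarrow> 'w \<Rightarrow> 'a) \<Rightarrow> (nat \<Rightarrow> 'w \<Rightarrow> 'a) \<Rightarrow> (nat \<Rightarrow> 'w \<Rightarrow> 'a) \<Rightarrow> bool"
where
  "sfbf M A B \<theta> eps lam x w y r s \<longleftrightarrow>
     (\<forall>k\<in>{-1, 0}. x k \<in> borel_measurable M \<and> integrable M (\<lambda>\<omega>. (norm (x k \<omega>))\<^sup>2)) \<and>
     (\<forall>n. r n \<in> borel_measurable M \<and> s n \<in> borel_measurable M \<and>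
          is_cond_exp M (history M x r n) (s n) (\<lambda>\<omega>. B (y n \<omega>)) \<and>
          (\<forall>\<omega>\<in>space M.
             w n \<omega> = x (int n) \<omega> + inertia \<theta> eps x n \<omega> *\<^sub>R (x (int n) \<omega> - x (int n - 1) \<omega>) \<and>
             resolvent (op_scale (lam n) A) (w n \<omega> - lam n *\<^sub>R r n \<omega>) = {y n \<omega>} \<and>
             x (int n + 1) \<omega> = y n \<omega> - lam n *\<^sub>R (s n \<omega> - r n \<omega>)))"

end

theory Submission imports Defs begin

text \<open>Put \<open>p\<^sub>n = y\<^sub>n - \<lambda>\<^sub>n (B y\<^sub>n - r\<^sub>n)\<close>, so that \<open>x\<^sub>n\<^sub>+\<^sub>1\<close> is \<open>p\<^sub>n\<close> plus a martingale difference. For every zero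
  \<open>z\<close> of \<open>A + B\<close>, monotonicity and the Lipschitz bound give a descent inequality for
  \<open>\<parallel>p\<^sub>n - z\<parallel>\<^sup>2\<close> with gain \<open>\<delta> \<parallel>w\<^sub>n - y\<^sub>n\<parallel>\<^sup>2 + 2 \<langle>y\<^sub>n - z, w\<^sub>n - p\<^sub>n\<rangle>\<close> and error
  \<open>\<lambda>\<^sub>n\<^sup>2 \<parallel>r\<^sub>n - B w\<^sub>n\<parallel>\<^sup>2 / \<delta>\<close>, while the inertial term costs only a factor \<open>1 + \<epsilon>\<^sub>n\<close> and a summable
  error. The Robbins-Siegmund theorem then yields a.s. convergence of \<open>\<parallel>x\<^sub>n - z\<parallel>\<close> and
  summability of the gains. For (i), this holds simultaneously for a countable dense set of zeros,
  weak cluster points are zeros because \<open>A + B\<close> is demiclosed at \<open>0\<close>, and Opial's lemma applies.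
  For (ii), \<open>\<Sum> \<lambda>\<^sub>n = \<infinity>\<close> forces the modulus \<open>\<phi>(\<parallel>y\<^sub>n - z\<parallel>)\<close> to be small along a subsequence, so the
  limit of \<open>\<parallel>x\<^sub>n - z\<parallel>\<close> is \<open>0\<close>.\<close>

section \<open>Nonnegative supermartingales\<close>

text \<open>The obstacle is integrability. The error series are finite only almost surely,
  \<open>r n\<close> is merely measurable and \<open>s n\<close> merely integrable, so the squared
  distance from \<open>x n\<close> to a zero may have infinite expectation. Every conditional
  inequality is therefore stated as a comparison of integrals with values in
  \<open>[0, \<infinity>]\<close>, taken over all sets of the n-th sigma-algebra; finiteness is
  recovered where subtraction occurs, by stopping in the Robbins-Siegmund argument and by truncation
  when the cross term of a martingale difference is removed. The constant \<open>\<delta>\<close>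
  measures how far \<open>lam n * L\<close> stays below 1. The squared correction step is split by
  convexity with weights \<open>1 - \<delta>\<close> and \<open>\<delta>\<close>, which leaves the
  gain \<open>\<delta>\<close> and produces the factor \<open>1 / \<delta>\<close> in front of the
  error. In (i) \<open>\<delta> = \<epsilon>\<close>; in (ii) the step sizes tend to 0, so
  \<open>\<delta> = 1/2\<close> is available from some index on. In (i) the null set off which the
  distances to \<open>z\<close> converge depends on \<open>z\<close>, which is why only countably
  many zeros are treated at once.\<close>

locale filtered_prob_space = prob_space M for M :: "'w measure" +
  fixes F :: "nat \<Rightarrow> 'w measure"
  assumes subalgebra_F: "subalgebra M (F n)"
    and subalgebra_Suc: "subalgebra (F (Suc n)) (F n)"
begin

lemma space_F [simp]: "space (F n) = space M"
  using subalgebra_F[of n] by (simp add: subalgebra_def)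

lemma sets_F_subset: "S \<in> sets (F n) \<Longrightarrow> S \<in> sets M"
  using subalgebra_F[of n] by (auto simp: subalgebra_def)

lemma measurable_F_M: "f \<in> measurable (F n) N \<Longrightarrow> f \<in> measurable M N"
  by (rule measurable_from_subalg[OF subalgebra_F])

lemma measurable_F_mono: "m \<le> n \<Longrightarrow> f \<in> measurable (F m) N \<Longrightarrow> f \<in> measurable (F n) N"
proof (induction n rule: dec_induct)
  case (step n)
  then show ?case
    using measurable_from_subalg[OF subalgebra_Suc] by blast
qed

end

text \<open>Doob's upcrossing strategy: buy when the price is below \<open>a\<close>, sell as soon as it exceeds \<open>b\<close>.\<close>

fun holding :: "real \<Rightarrow> real \<Rightarrow> (nat \<Rightarrow> real) \<Rightarrow> nat \<Rightarrow> bool" where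
  "holding a b f 0 \<longleftrightarrow> f 0 < a"
| "holding a b f (Suc n) \<longleftrightarrow> (if holding a b f n then f (Suc n) \<le> b else f (Suc n) < a)"

definition upcrossings :: "real \<Rightarrow> real \<Rightarrow> (nat \<Rightarrow> real) \<Rightarrow> nat \<Rightarrow> real" where
  "upcrossings a b f n = (\<Sum>m<n. if holding a b f m \<and> \<not> holding a b f (Suc m) then 1 else 0)"

text \<open>Bookkeeping of a trader who owns one unit exactly while \<open>holding\<close> is true.
  A completed round trip buys below \<open>a\<close> and sells above \<open>b\<close>, so it earns
  at least \<open>b - a\<close>; the term \<open>f n - a\<close> bounds from below the result of a
  position still open at time \<open>n\<close>.\<close>

lemma upcrossings_gain:
  assumes "a < b"
  shows "(b - a) * upcrossings a b f n + (if holding a b f n then f n - a else 0)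
    \<le> (\<Sum>m<n. of_bool (holding a b f m) * (f (Suc m) - f m))"
  using assms by (induction n) (auto simp: upcrossings_def algebra_simps split: if_splits)

text \<open>Boundedly many upcrossings mean that no sale happens after some time \<open>N\<close>.
  From then on either a position is kept forever, which forces \<open>f \<le> b\<close>, or none is
  ever opened, which forces \<open>a \<le> f\<close>.\<close>

lemma bounded_upcrossings_imp:
  assumes bdd: "\<And>n. upcrossings a b f n \<le> K"
  shows "(\<forall>\<^sub>F n in sequentially. f n \<le> b) \<or> (\<forall>\<^sub>F n in sequentially. a \<le> f n)"
proof -
  let ?u = "\<lambda>m. if holding a b f m \<and> \<not> holding a b f (Suc m) then 1 else 0 :: real"
  have "(\<Sum>i\<le>n. ?u i) \<le> K" for n
    using bdd[of "Suc n"] unfolding upcrossings_def lessThan_Suc_atMost .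
  then have "summable ?u"
    by (intro bounded_imp_summable[of _ K]) auto
  then have "?u \<longlonglongrightarrow> 0"
    by (rule summable_LIMSEQ_zero)
  then have "\<forall>\<^sub>F m in sequentially. ?u m < 1"
    by (rule order_tendstoD) simp
  then obtain N where N: "\<And>m. m \<ge> N \<Longrightarrow> holding a b f m \<Longrightarrow> holding a b f (Suc m)"
    unfolding eventually_sequentially by (auto split: if_splits)
  show ?thesis
  proof (cases "\<exists>m\<ge>N. holding a b f m")
    case True
    then obtain m where m: "m \<ge> N" "holding a b f m" by blast
    have "holding a b f n" if "n \<ge> m" for n
      using that by (induction n rule: dec_induct) (use m N in auto)
    then have "f (Suc n) \<le> b" if "n \<ge> m" for n
      using that by (metis holding.simps(2) le_SucI)
    then have "f n \<le> b" if "n \<ge> Suc m" for n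
      using that by (cases n) auto
    then show ?thesis
      unfolding eventually_sequentially by blast
  next
    case False
    then have "a \<le> f (Suc n)" if "n \<ge> N" for n
      using that by (metis holding.simps(2) le_SucI not_le)
    then have "a \<le> f n" if "n \<ge> Suc N" for n
      using that by (cases n) auto
    then show ?thesis
      unfolding eventually_sequentially by blast
  qed
qed

text \<open>In \<open>ennreal\<close> liminf and limsup always exist, and a strict gap between them
  would contain positive rationals \<open>a < b\<close> that \<open>osc\<close> excludes. The
  hypothesis \<open>fin\<close> makes the common value a real number.\<close>

lemma convergent_if_no_oscillation:
  fixes f :: "nat \<Rightarrow> real"
  assumes nonneg: "\<And>n. 0 \<le> f n"
    and osc: "\<And>a b. a \<in> \<rat> \<Longrightarrow> b \<in> \<rat> \<Longrightarrow> 0 < a \<Longrightarrow> a < b \<Longrightarrow>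
      (\<forall>\<^sub>F n in sequentially. f n \<le> b) \<or> (\<forall>\<^sub>F n in sequentially. a \<le> f n)"
    and fin: "liminf (\<lambda>n. ennreal (f n)) < \<infinity>"
  shows "convergent f"
proof -
  let ?g = "\<lambda>n. ennreal (f n)"
  have "limsup ?g \<le> liminf ?g"
  proof (rule ccontr)
    assume "\<not> limsup ?g \<le> liminf ?g"
    then have lt: "liminf ?g < limsup ?g" by simp
    obtain c where c: "liminf ?g < ennreal c" "ennreal c < limsup ?g" "0 \<le> c"
      using dense[OF lt] by (metis ennreal_cases less_top[symmetric] order_less_imp_not_eq2 top_greatest leD)
    obtain d where d: "ennreal c < ennreal d" "ennreal d < limsup ?g" "0 \<le> d"
      using dense[OF c(2)] by (metis ennreal_cases less_top[symmetric] order_less_imp_not_eq2 top_greatest leD)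
    have "c < d" using d c by (simp add: ennreal_less_iff)
    then obtain a where a: "a \<in> \<rat>" "c < a" "a < d" using Rats_dense_in_real by blast
    then obtain b where b: "b \<in> \<rat>" "a < b" "b < d" using Rats_dense_in_real by blast
    have "0 < a" using a c by simp
    from osc[OF a(1) b(1) this b(2)] show False
    proof
      assume "\<forall>\<^sub>F n in sequentially. f n \<le> b"
      then have "\<forall>\<^sub>F n in sequentially. ?g n \<le> ennreal b"
        by eventually_elim (simp add: ennreal_leI)
      then have "limsup ?g \<le> ennreal b" by (rule Limsup_bounded)
      also have "\<dots> \<le> ennreal d" using b by (simp add: ennreal_leI)
      finally show False using d by simp
    next
      assume "\<forall>\<^sub>F n in sequentially. a \<le> f n"
      then have "\<forall>\<^sub>F n in sequentially. ennreal a \<le> ?g n"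
        by eventually_elim (simp add: ennreal_leI)
      then have "ennreal a \<le> liminf ?g" by (rule Liminf_bounded)
      moreover have "ennreal c \<le> ennreal a" using a by (simp add: ennreal_leI)
      ultimately show False using c by auto
    qed
  qed
  moreover have "liminf ?g \<le> limsup ?g" by (rule Liminf_le_Limsup) simp
  ultimately have eq: "limsup ?g = liminf ?g" by simp
  obtain l where l: "liminf ?g = ennreal l" "0 \<le> l"
    using fin by (cases "liminf ?g") auto
  have "?g \<longlonglongrightarrow> ennreal l"
    by (rule Liminf_eq_Limsup) (use l eq in auto)
  then have "f \<longlonglongrightarrow> l"
    using nonneg l by (simp add: tendsto_ennreal_iff)
  then show ?thesis by (rule convergentI)
qed

context filtered_prob_space
begin

text \<open>Doob's convergence theorem. The upcrossing strategy has nonpositive expected gain, and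
  as \<open>X\<close> is nonnegative an open position loses at most \<open>a\<close>, so the
  expected number of upcrossings is at most \<open>a / (b - a)\<close>. Fatou's lemma keeps the
  liminf finite.\<close>

lemma nonneg_supermartingale_convergent:
  fixes X :: "nat \<Rightarrow> 'w \<Rightarrow> real"
  assumes meas [measurable]: "\<And>n. X n \<in> borel_measurable (F n)"
    and nonneg: "\<And>n \<omega>. 0 \<le> X n \<omega>"
    and init: "(\<integral>\<^sup>+\<omega>. X 0 \<omega> \<partial>M) < \<infinity>"
    and dec: "\<And>n S. S \<in> sets (F n) \<Longrightarrow>
      (\<integral>\<^sup>+\<omega>\<in>S. X (Suc n) \<omega> \<partial>M) \<le> (\<integral>\<^sup>+\<omega>\<in>S. X n \<omega> \<partial>M)"
  shows "AE \<omega> in M. convergent (\<lambda>n. X n \<omega>)"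
proof -
  have measM [measurable]: "X n \<in> borel_measurable M" for n
    by (rule measurable_F_M[OF meas])
  have bound: "(\<integral>\<^sup>+\<omega>. X n \<omega> \<partial>M) \<le> (\<integral>\<^sup>+\<omega>. X 0 \<omega> \<partial>M)" for n
  proof (induction n)
    case (Suc n)
    have "(\<integral>\<^sup>+\<omega>. X (Suc n) \<omega> \<partial>M) \<le> (\<integral>\<^sup>+\<omega>. X n \<omega> \<partial>M)"
      using dec[of "space M" n] sets.top[of "F n"]
      by (simp add: nn_integral_set_ennreal[symmetric] cong: nn_integral_cong_simp)
    then show ?case using Suc by simp
  qed simp
  have int: "integrable M (X n)" for n
    using bound[of n] init nonneg by (intro integrableI_nonneg) (auto simp: less_top[symmetric] top_unique)
  have hold [measurable]: "Measurable.pred (F n) (\<lambda>\<omega>. holding a b (\<lambda>n. X n \<omega>) n)" for a b :: real and n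
  proof (induction n)
    case (Suc n)
    have [measurable]: "Measurable.pred (F (Suc n)) (\<lambda>\<omega>. holding a b (\<lambda>n. X n \<omega>) n)"
      using measurable_F_mono[OF _ Suc, of "Suc n"] by simp
    show ?case by simp
  qed simp
  have holdM [measurable]: "Measurable.pred M (\<lambda>\<omega>. holding a b (\<lambda>n. X n \<omega>) n)" for a b :: real and n
    using measurable_F_M[OF hold] .
  \<comment> \<open>Whether a unit is held is decided at time \<open>n\<close>, so the holding event
    lies in \<open>F n\<close> and \<open>dec\<close> applies to the next increment on it.\<close>
  have step: "(\<integral>\<omega>. of_bool (holding a b (\<lambda>n. X n \<omega>) n) * (X (Suc n) \<omega> - X n \<omega>) \<partial>M) \<le> 0" for a b :: real and n
  proof -
    define S where "S = {\<omega> \<in> space M. holding a b (\<lambda>n. X n \<omega>) n}"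
    have SF: "S \<in> sets (F n)"
      using hold[of a b n] unfolding pred_def S_def by simp
    note [measurable] = sets_F_subset[OF SF]
    have eq: "(\<integral>\<^sup>+\<omega>\<in>S. X m \<omega> \<partial>M) = ennreal (\<integral>\<omega>. X m \<omega> * indicator S \<omega> \<partial>M)" for m
    proof -
      have "(\<integral>\<^sup>+\<omega>\<in>S. X m \<omega> \<partial>M) = (\<integral>\<^sup>+\<omega>. ennreal (X m \<omega> * indicator S \<omega>) \<partial>M)"
        by (intro nn_integral_cong) (auto split: split_indicator)
      also have "\<dots> = ennreal (\<integral>\<omega>. X m \<omega> * indicator S \<omega> \<partial>M)"
        using int nonneg by (intro nn_integral_eq_integral integrable_real_mult_indicator) auto
      finally show ?thesis .
    qed
    have "(\<integral>\<omega>. X (Suc n) \<omega> * indicator S \<omega> \<partial>M) \<le> (\<integral>\<omega>. X n \<omega> * indicator S \<omega> \<partial>M)"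
      using dec[OF SF] unfolding eq
      by (subst (asm) ennreal_le_iff) (auto intro!: integral_nonneg_AE simp: nonneg)
    moreover have "(\<integral>\<omega>. of_bool (holding a b (\<lambda>n. X n \<omega>) n) * (X (Suc n) \<omega> - X n \<omega>) \<partial>M)
      = (\<integral>\<omega>. X (Suc n) \<omega> * indicator S \<omega> - X n \<omega> * indicator S \<omega> \<partial>M)"
      by (intro Bochner_Integration.integral_cong) (auto simp: S_def algebra_simps split: split_indicator)
    moreover have "\<dots> = (\<integral>\<omega>. X (Suc n) \<omega> * indicator S \<omega> \<partial>M) - (\<integral>\<omega>. X n \<omega> * indicator S \<omega> \<partial>M)"
      using int by (intro Bochner_Integration.integral_diff) (auto intro!: integrable_real_mult_indicator)
    ultimately show ?thesis by simp
  qed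
  have up: "AE \<omega> in M. \<exists>K. \<forall>n. upcrossings a b (\<lambda>n. X n \<omega>) n \<le> K" if ab: "0 < a" "a < b" for a b :: real
  proof -
    let ?U = "\<lambda>n \<omega>. upcrossings a b (\<lambda>n. X n \<omega>) n"
    have [measurable]: "?U n \<in> borel_measurable M" for n
      unfolding upcrossings_def by measurable
    have U_nonneg: "0 \<le> ?U n \<omega>" for n \<omega>
      unfolding upcrossings_def by (auto intro: sum_nonneg)
    have U_le: "?U n \<omega> \<le> real n" for n \<omega>
      unfolding upcrossings_def using sum_bounded_above[of "{..<n}" _ "1::real"] by fastforce
    have Uint: "integrable M (?U n)" for n
      using U_nonneg U_le by (intro integrable_const_bound[of _ "real n"]) auto
    have gint: "integrable M (\<lambda>\<omega>. of_bool (holding a b (\<lambda>n. X n \<omega>) m) * (X (Suc m) \<omega> - X m \<omega>))" for m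
      using int by (intro Bochner_Integration.integrable_bound[where g="\<lambda>\<omega>. of_bool (holding a b (\<lambda>n. X n \<omega>) m) * (X (Suc m) \<omega> - X m \<omega>)" and f="\<lambda>\<omega>. X (Suc m) \<omega> - X m \<omega>"]) auto
    have EU: "(\<integral>\<^sup>+\<omega>. ?U n \<omega> \<partial>M) \<le> ennreal (a / (b - a))" for n
    proof -
      have "(\<integral>\<omega>. (b - a) * ?U n \<omega> - a \<partial>M)
        \<le> (\<integral>\<omega>. (\<Sum>m<n. of_bool (holding a b (\<lambda>n. X n \<omega>) m) * (X (Suc m) \<omega> - X m \<omega>)) \<partial>M)"
      proof (rule integral_mono)
        fix \<omega>
        show "(b - a) * ?U n \<omega> - a \<le> (\<Sum>m<n. of_bool (holding a b (\<lambda>n. X n \<omega>) m) * (X (Suc m) \<omega> - X m \<omega>))"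
          using upcrossings_gain[of a b "\<lambda>n. X n \<omega>" n] nonneg[of n \<omega>] ab by (auto split: if_splits)
      qed (intro Bochner_Integration.integrable_sum gint Bochner_Integration.integrable_diff
          integrable_mult_right Uint integrable_const)+
      also have "\<dots> = (\<Sum>m<n. \<integral>\<omega>. of_bool (holding a b (\<lambda>n. X n \<omega>) m) * (X (Suc m) \<omega> - X m \<omega>) \<partial>M)"
        by (intro Bochner_Integration.integral_sum gint)
      also have "\<dots> \<le> 0" using step by (intro sum_nonpos)
      finally have "(b - a) * (\<integral>\<omega>. ?U n \<omega> \<partial>M) \<le> a"
        using Uint by (simp add: prob_space)
      then have "(\<integral>\<omega>. ?U n \<omega> \<partial>M) \<le> a / (b - a)"
        using ab by (simp add: field_simps)
      then show ?thesis
        using Uint U_nonneg by (subst nn_integral_eq_integral) (auto intro: ennreal_leI)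
    qed
    have "(\<integral>\<^sup>+\<omega>. (SUP n. ennreal (?U n \<omega>)) \<partial>M) = (SUP n. \<integral>\<^sup>+\<omega>. ?U n \<omega> \<partial>M)"
      by (intro nn_integral_monotone_convergence_SUP incseq_SucI le_funI ennreal_leI)
        (auto simp: upcrossings_def)
    also have "\<dots> \<le> ennreal (a / (b - a))" using EU by (intro SUP_least)
    finally have "(\<integral>\<^sup>+\<omega>. (SUP n. ennreal (?U n \<omega>)) \<partial>M) \<noteq> \<infinity>"
      by (auto simp: top_unique)
    then have "AE \<omega> in M. (SUP n. ennreal (?U n \<omega>)) \<noteq> \<infinity>"
      by (intro nn_integral_noteq_infinite) auto
    then show ?thesis
    proof eventually_elim
      case (elim \<omega>)
      then obtain K where K: "(SUP n. ennreal (?U n \<omega>)) = ennreal K" "0 \<le> K"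
        by (cases "SUP n. ennreal (?U n \<omega>)") auto
      have "ennreal (?U n \<omega>) \<le> ennreal K" for n
        unfolding K(1)[symmetric] by (rule SUP_upper) simp
      then show ?case using K(2) by (auto simp: ennreal_le_iff)
    qed
  qed
  \<comment> \<open>Rational levels leave countably many pairs, so one null set serves all of
    them.\<close>
  have osc: "AE \<omega> in M. \<forall>a\<in>\<rat>. \<forall>b\<in>\<rat>. 0 < a \<longrightarrow> a < b \<longrightarrow>
      (\<exists>K. \<forall>n. upcrossings a b (\<lambda>n. X n \<omega>) n \<le> K)"
    using up by (intro AE_ball_countable[THEN iffD2] ballI countable_rat AE_impI) auto
  have "(\<integral>\<^sup>+\<omega>. liminf (\<lambda>n. ennreal (X n \<omega>)) \<partial>M) \<le> liminf (\<lambda>n. \<integral>\<^sup>+\<omega>. X n \<omega> \<partial>M)"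
    by (rule nn_integral_liminf) simp
  also have "\<dots> \<le> (\<integral>\<^sup>+\<omega>. X 0 \<omega> \<partial>M)"
    using bound by (intro Liminf_le) auto
  finally have "AE \<omega> in M. liminf (\<lambda>n. ennreal (X n \<omega>)) \<noteq> \<infinity>"
    using init by (intro nn_integral_noteq_infinite) auto
  with osc show ?thesis
  proof eventually_elim
    case (elim \<omega>)
    show ?case
    proof (rule convergent_if_no_oscillation)
      fix a b :: real assume "a \<in> \<rat>" "b \<in> \<rat>" "0 < a" "a < b"
      then obtain K where "\<And>n. upcrossings a b (\<lambda>n. X n \<omega>) n \<le> K" using elim(1) by blast
      then show "(\<forall>\<^sub>F n in sequentially. X n \<omega> \<le> b) \<or> (\<forall>\<^sub>F n in sequentially. a \<le> X n \<omega>)"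
        by (rule bounded_upcrossings_imp)
    qed (use nonneg elim in \<open>auto simp: less_top\<close>)
  qed
qed

text \<open>\<open>V 0\<close> need not be integrable: the process is stopped before \<open>V 0\<close> or the partial sums of \<open>b\<close>
  exceed a level \<open>k\<close>, which makes \<open>V\<^sub>n + \<Sum> c\<^sub>i + (k - \<Sum> b\<^sub>i)\<close> a nonnegative supermartingale.\<close>

lemma robbins_siegmund_additive:
  fixes V b c :: "nat \<Rightarrow> 'w \<Rightarrow> real"
  assumes V [measurable]: "\<And>n. V n \<in> borel_measurable (F n)"
    and b [measurable]: "\<And>n. b n \<in> borel_measurable (F n)"
    and c [measurable]: "\<And>n. c n \<in> borel_measurable (F n)"
    and V0: "\<And>n \<omega>. 0 \<le> V n \<omega>" and b0: "\<And>n \<omega>. 0 \<le> b n \<omega>" and c0: "\<And>n \<omega>. 0 \<le> c n \<omega>"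
    and b_sum: "AE \<omega> in M. summable (\<lambda>n. b n \<omega>)"
    and step: "\<And>n S. S \<in> sets (F n) \<Longrightarrow>
      (\<integral>\<^sup>+\<omega>\<in>S. ennreal (V (Suc n) \<omega> + c n \<omega>) \<partial>M) \<le> (\<integral>\<^sup>+\<omega>\<in>S. ennreal (V n \<omega> + b n \<omega>) \<partial>M)"
  shows "AE \<omega> in M. convergent (\<lambda>n. V n \<omega>) \<and> summable (\<lambda>n. c n \<omega>)"
proof -
  \<comment> \<open>The event that the process still runs at time \<open>n\<close>. It involves
    \<open>b i\<close> only for \<open>i < n\<close>, so \<open>G k (Suc n)\<close> is already known
    at time \<open>n\<close>: the stopping is predictable, and therefore the sums in
    \<open>R\<close> carry the factor \<open>g k (Suc i)\<close>.\<close>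
  define G where "G k n \<omega> \<longleftrightarrow> V 0 \<omega> \<le> real k \<and> (\<Sum>i<n. b i \<omega>) \<le> real k" for k n \<omega>
  define g where "g k n \<omega> = (if G k n \<omega> then 1 else 0 :: real)" for k n \<omega>
  define R where "R k n \<omega> = (\<Sum>i<n. g k (Suc i) \<omega> * c i \<omega>) + (real k - (\<Sum>i<n. g k (Suc i) \<omega> * b i \<omega>))" for k n \<omega>
  define W where "W k n \<omega> = g k n \<omega> * V n \<omega> + R k n \<omega>" for k n \<omega>
  have Vm [measurable]: "V i \<in> borel_measurable (F n)" if "i \<le> n" for i n
    using measurable_F_mono[OF that V] .
  have bm [measurable]: "b i \<in> borel_measurable (F n)" if "i \<le> n" for i n
    using measurable_F_mono[OF that b] .
  have cm [measurable]: "c i \<in> borel_measurable (F n)" if "i \<le> n" for i n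
    using measurable_F_mono[OF that c] .
  have Gm [measurable]: "Measurable.pred (F n) (G k i)" if "i \<le> Suc n" for k i n
    unfolding G_def using that by (intro pred_intros_logic borel_measurable_le[unfolded pred_def[symmetric]] borel_measurable_sum) (auto simp: pred_def)
  have gm [measurable]: "g k i \<in> borel_measurable (F n)" if "i \<le> Suc n" for k i n
    unfolding g_def using Gm[OF that] by measurable
  have Rm [measurable]: "R k n \<in> borel_measurable (F n)" for k n
    unfolding R_def by (intro borel_measurable_add borel_measurable_diff borel_measurable_sum borel_measurable_times gm cm bm) auto
  have Wm [measurable]: "W k n \<in> borel_measurable (F n)" for k n
    unfolding W_def by (intro borel_measurable_add borel_measurable_times gm V Rm) auto
  have G_anti: "G k m \<omega>" if "G k n \<omega>" "m \<le> n" for k m n \<omega>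
  proof -
    have "(\<Sum>i<m. b i \<omega>) \<le> (\<Sum>i<n. b i \<omega>)"
      using that b0 by (intro sum_mono2) auto
    then show ?thesis using that by (auto simp: G_def)
  qed
  have gb_le: "(\<Sum>i<n. g k (Suc i) \<omega> * b i \<omega>) \<le> real k" for k n \<omega>
  proof (induction n)
    case (Suc n)
    show ?case
    proof (cases "G k (Suc n) \<omega>")
      case True
      then have "(\<Sum>i<Suc n. g k (Suc i) \<omega> * b i \<omega>) = (\<Sum>i<Suc n. b i \<omega>)"
        by (intro sum.cong) (auto simp: g_def intro: G_anti)
      then show ?thesis using True by (simp add: G_def)
    qed (use Suc in \<open>simp add: g_def\<close>)
  qed simp
  have R0: "0 \<le> R k n \<omega>" for k n \<omega>
    using gb_le[of k \<omega> n] c0 by (auto simp: R_def g_def intro!: add_nonneg_nonneg sum_nonneg)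
  have "AE \<omega> in M. convergent (\<lambda>n. W k n \<omega>)" for k
  proof (rule nonneg_supermartingale_convergent)
    show "0 \<le> W k n \<omega>" for n \<omega>
      using R0 V0 by (simp add: W_def g_def)
    have "(\<integral>\<^sup>+\<omega>. W k 0 \<omega> \<partial>M) \<le> (\<integral>\<^sup>+\<omega>. ennreal (2 * real k) \<partial>M)"
      by (intro nn_integral_mono ennreal_leI) (auto simp: W_def R_def g_def G_def)
    then show "(\<integral>\<^sup>+\<omega>. W k 0 \<omega> \<partial>M) < \<infinity>"
      by (simp add: emeasure_space_1 order.strict_trans1)
    fix n S assume S: "S \<in> sets (F n)"
    define T where "T = S \<inter> {\<omega>\<in>space M. G k (Suc n) \<omega>}"
    have T: "T \<in> sets (F n)"
      using S Gm[of "Suc n" n k] unfolding T_def pred_def by auto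
    have S_space: "S \<subseteq> space M" using sets.sets_into_space[OF S] by simp
    note [measurable] = sets_F_subset[OF S] sets_F_subset[OF T]
      measurable_F_M[OF V] measurable_F_M[OF b] measurable_F_M[OF c] measurable_F_M[OF Rm] measurable_F_M[OF Wm]
    have gMm [measurable]: "g k (Suc n) \<in> borel_measurable M"
      using measurable_F_M[OF gm] by blast
    let ?b = "\<integral>\<^sup>+\<omega>\<in>S. ennreal (g k (Suc n) \<omega> * b n \<omega>) \<partial>M"
    let ?R = "\<integral>\<^sup>+\<omega>\<in>S. ennreal (R k n \<omega>) \<partial>M"
    \<comment> \<open>One summand of the sum bounded in \<open>gb_le\<close>. The resulting
      finiteness of \<open>?b\<close> is what allows it to be cancelled from both sides at the
      end.\<close>
    have "g k (Suc n) \<omega> * b n \<omega> \<le> real k" for \<omega>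
      using gb_le[of k \<omega> "Suc n"] b0 sum_nonneg[of "{..<n}" "\<lambda>i. g k (Suc i) \<omega> * b i \<omega>"]
      by (auto simp: g_def)
    then have "?b \<le> (\<integral>\<^sup>+\<omega>. ennreal (real k) \<partial>M)"
      by (intro nn_integral_mono) (auto intro: ennreal_leI split: split_indicator)
    then have b_fin: "?b < \<infinity>"
      by (simp add: emeasure_space_1 order.strict_trans1)
    have restrict: "(\<integral>\<^sup>+\<omega>\<in>T. ennreal (f \<omega>) \<partial>M) = (\<integral>\<^sup>+\<omega>\<in>S. ennreal (g k (Suc n) \<omega> * f \<omega>) \<partial>M)" for f
      by (intro nn_integral_cong) (auto simp: T_def g_def split: split_indicator)
    have split: "(\<integral>\<^sup>+\<omega>\<in>S. ennreal (f \<omega> + h \<omega>) \<partial>M) = (\<integral>\<^sup>+\<omega>\<in>S. ennreal (f \<omega>) \<partial>M) + (\<integral>\<^sup>+\<omega>\<in>S. ennreal (h \<omega>) \<partial>M)"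
      if "f \<in> borel_measurable M" "h \<in> borel_measurable M" "\<And>\<omega>. 0 \<le> f \<omega>" "\<And>\<omega>. 0 \<le> h \<omega>" for f h
      using that by (subst nn_integral_add[symmetric]) (auto intro!: nn_integral_cong split: split_indicator)
    have g0: "0 \<le> g k (Suc n) \<omega>" for \<omega> by (simp add: g_def)
    have W0: "0 \<le> W k (Suc n) \<omega>" for \<omega>
      using R0 V0 by (simp add: W_def g_def)
    have "(\<integral>\<^sup>+\<omega>\<in>S. W k (Suc n) \<omega> \<partial>M) + ?b = (\<integral>\<^sup>+\<omega>\<in>S. ennreal (W k (Suc n) \<omega> + g k (Suc n) \<omega> * b n \<omega>) \<partial>M)"
      by (rule split[symmetric]) (use W0 g0 b0 in auto)
    also have "\<dots> = (\<integral>\<^sup>+\<omega>\<in>S. ennreal (g k (Suc n) \<omega> * (V (Suc n) \<omega> + c n \<omega>) + R k n \<omega>) \<partial>M)"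
      by (simp add: W_def R_def algebra_simps)
    also have "\<dots> = (\<integral>\<^sup>+\<omega>\<in>T. ennreal (V (Suc n) \<omega> + c n \<omega>) \<partial>M) + ?R"
      unfolding restrict by (rule split) (use V0 c0 R0 g0 in auto)
    also have "\<dots> \<le> (\<integral>\<^sup>+\<omega>\<in>T. ennreal (V n \<omega> + b n \<omega>) \<partial>M) + ?R"
      by (intro add_right_mono step T)
    also have "\<dots> = (\<integral>\<^sup>+\<omega>\<in>S. ennreal (g k (Suc n) \<omega> * (V n \<omega> + b n \<omega>) + R k n \<omega>) \<partial>M)"
      unfolding restrict by (rule split[symmetric]) (use V0 b0 R0 g0 in auto)
    \<comment> \<open>On paths stopped between times \<open>n\<close> and \<open>Suc n\<close> the
      term \<open>V n\<close> is missing on the left; since \<open>V\<close> is nonnegative, this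
      goes in the required direction.\<close>
    also have "\<dots> \<le> (\<integral>\<^sup>+\<omega>\<in>S. ennreal (W k n \<omega> + g k (Suc n) \<omega> * b n \<omega>) \<partial>M)"
    proof (intro nn_integral_mono mult_right_mono ennreal_leI)
      fix \<omega>
      have "g k (Suc n) \<omega> \<le> g k n \<omega>"
        using G_anti[of k "Suc n" \<omega> n] by (auto simp: g_def)
      then have "g k (Suc n) \<omega> * V n \<omega> \<le> g k n \<omega> * V n \<omega>"
        using V0 by (intro mult_right_mono)
      then show "g k (Suc n) \<omega> * (V n \<omega> + b n \<omega>) + R k n \<omega> \<le> W k n \<omega> + g k (Suc n) \<omega> * b n \<omega>"
        by (simp add: W_def algebra_simps)
    qed simp
    also have "\<dots> = (\<integral>\<^sup>+\<omega>\<in>S. W k n \<omega> \<partial>M) + ?b"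
    proof (rule split)
      show "0 \<le> W k n \<omega>" for \<omega>
        using R0 V0 by (simp add: W_def g_def)
    qed (use g0 b0 in auto)
    finally show "(\<integral>\<^sup>+\<omega>\<in>S. W k (Suc n) \<omega> \<partial>M) \<le> (\<integral>\<^sup>+\<omega>\<in>S. W k n \<omega> \<partial>M)"
      using b_fin by (auto simp: add.commute[of _ ?b] ennreal_add_left_cancel_le)
  qed (rule Wm)
  then have "AE \<omega> in M. \<forall>k. convergent (\<lambda>n. W k n \<omega>)"
    by (simp add: AE_all_countable)
  with b_sum show ?thesis
  proof eventually_elim
    case (elim \<omega>)
    \<comment> \<open>A level that never stops the path \<open>\<omega>\<close>. It depends on
      \<open>\<omega>\<close>, which is harmless because \<open>W k\<close> converges for all
      natural \<open>k\<close> off one null set.\<close>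
    obtain k where k: "max (V 0 \<omega>) (suminf (\<lambda>n. b n \<omega>)) \<le> real k"
      using real_arch_simple by blast
    have "(\<Sum>i<n. b i \<omega>) \<le> suminf (\<lambda>n. b n \<omega>)" for n
      using elim b0 by (intro sum_le_suminf) auto
    then have G: "G k n \<omega>" for n
      using k by (auto simp: G_def intro: order_trans)
    have W_eq: "W k n \<omega> = V n \<omega> + (\<Sum>i<n. c i \<omega>) + (real k - (\<Sum>i<n. b i \<omega>))" for n
      using G by (simp add: W_def R_def g_def)
    have "convergent (\<lambda>n. W k n \<omega>)"
      using elim by blast
    then have "convergent (\<lambda>n. V n \<omega> + (\<Sum>i<n. c i \<omega>) + (real k - (\<Sum>i<n. b i \<omega>)))"
      unfolding W_eq .
    moreover have "convergent (\<lambda>n. real k - (\<Sum>i<n. b i \<omega>))"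
      using elim by (intro convergent_diff convergent_const) (simp add: summable_iff_convergent)
    ultimately have "convergent (\<lambda>n. (V n \<omega> + (\<Sum>i<n. c i \<omega>) + (real k - (\<Sum>i<n. b i \<omega>))) - (real k - (\<Sum>i<n. b i \<omega>)))"
      by (rule convergent_diff)
    then have conv: "convergent (\<lambda>n. V n \<omega> + (\<Sum>i<n. c i \<omega>))" by simp
    then obtain K where K: "\<And>n. \<bar>V n \<omega> + (\<Sum>i<n. c i \<omega>)\<bar> \<le> K"
      using convergent_imp_Bseq[OF conv] unfolding Bseq_def by auto
    have "(\<Sum>i\<le>n. c i \<omega>) \<le> K" for n
      using K[of "Suc n"] V0[of "Suc n" \<omega>] unfolding lessThan_Suc_atMost by linarith
    then have c_sum: "summable (\<lambda>n. c n \<omega>)"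
      using c0 by (intro bounded_imp_summable[of _ K]) auto
    then have "convergent (\<lambda>n. V n \<omega> + (\<Sum>i<n. c i \<omega>) - (\<Sum>i<n. c i \<omega>))"
      using conv summable_iff_convergent[THEN iffD1, OF c_sum] by (intro convergent_diff)
    with c_sum show ?case by simp
  qed
qed

text \<open>Dividing by the partial products \<open>P n\<close> of \<open>1 + a i\<close> absorbs
  the factor \<open>1 + a n\<close> and leaves the additive form. As \<open>P\<close> converges and
  stays between 1 and \<open>exp (suminf a)\<close>, convergence and summability survive multiplying
  back.\<close>

theorem robbins_siegmund:
  fixes V b c :: "nat \<Rightarrow> 'w \<Rightarrow> real" and a :: "nat \<Rightarrow> real"
  assumes V [measurable]: "\<And>n. V n \<in> borel_measurable (F n)"
    and b [measurable]: "\<And>n. b n \<in> borel_measurable (F n)"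
    and c [measurable]: "\<And>n. c n \<in> borel_measurable (F n)"
    and V0: "\<And>n \<omega>. 0 \<le> V n \<omega>" and b0: "\<And>n \<omega>. 0 \<le> b n \<omega>" and c0: "\<And>n \<omega>. 0 \<le> c n \<omega>"
    and a0: "\<And>n. 0 \<le> a n" and a_sum: "summable a"
    and b_sum: "AE \<omega> in M. summable (\<lambda>n. b n \<omega>)"
    and step: "\<And>n S. S \<in> sets (F n) \<Longrightarrow>
      (\<integral>\<^sup>+\<omega>\<in>S. ennreal (V (Suc n) \<omega> + c n \<omega>) \<partial>M)
        \<le> (\<integral>\<^sup>+\<omega>\<in>S. ennreal ((1 + a n) * V n \<omega> + b n \<omega>) \<partial>M)"
  shows "AE \<omega> in M. convergent (\<lambda>n. V n \<omega>) \<and> summable (\<lambda>n. c n \<omega>)"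
proof -
  define P where "P n = (\<Prod>i<n. 1 + a i)" for n
  have P1: "1 \<le> P n" for n
    unfolding P_def using a0 by (intro prod_ge_1) auto
  have P0: "0 < P n" for n using P1[of n] by simp
  have PSuc: "P (Suc n) = P n * (1 + a n)" for n by (simp add: P_def)
  have P_le: "P n \<le> exp (suminf a)" for n
  proof -
    have "P n \<le> (\<Prod>i<n. exp (a i))"
      unfolding P_def using a0 by (intro prod_mono) (auto simp: add_nonneg_nonneg exp_ge_add_one_self)
    also have "\<dots> = exp (\<Sum>i<n. a i)" by (simp add: exp_sum)
    also have "\<dots> \<le> exp (suminf a)" using a0 a_sum by (simp add: sum_le_suminf)
    finally show ?thesis .
  qed
  have "incseq P"
    using a0 P0 by (intro incseq_SucI) (simp add: PSuc less_imp_le)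
  then have P_conv: "convergent P"
    using P_le incseq_convergent[of P "exp (suminf a)"] unfolding convergent_def by blast
  have "AE \<omega> in M. convergent (\<lambda>n. V n \<omega> / P n) \<and> summable (\<lambda>n. c n \<omega> / P (Suc n))"
  proof (rule robbins_siegmund_additive[where b="\<lambda>n \<omega>. b n \<omega> / P (Suc n)"])
    show "AE \<omega> in M. summable (\<lambda>n. b n \<omega> / P (Suc n))"
      using b_sum
    proof eventually_elim
      case (elim \<omega>)
      show ?case
      proof (rule summable_comparison_test[OF _ elim], intro exI allI impI)
        fix n
        have "b n \<omega> * 1 \<le> b n \<omega> * P (Suc n)"
          using P1 b0 by (intro mult_left_mono)
        then show "norm (b n \<omega> / P (Suc n)) \<le> b n \<omega>"
          using P0[of "Suc n"] b0[of n \<omega>] by (simp add: field_simps)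
      qed
    qed
    fix n S assume S: "S \<in> sets (F n)"
    note [measurable] = sets_F_subset[OF S]
      measurable_F_M[OF V] measurable_F_M[OF b] measurable_F_M[OF c]
    have scale: "(\<integral>\<^sup>+\<omega>\<in>S. ennreal (f \<omega> / P (Suc n)) \<partial>M) = ennreal (1 / P (Suc n)) * (\<integral>\<^sup>+\<omega>\<in>S. ennreal (f \<omega>) \<partial>M)"
      if "f \<in> borel_measurable M" "\<And>\<omega>. 0 \<le> f \<omega>" for f
      using that P0[of "Suc n"]
      by (subst nn_integral_cmult[symmetric]) (auto simp: ennreal_mult'[symmetric] mult.assoc[symmetric] intro!: nn_integral_cong)
    have "(\<integral>\<^sup>+\<omega>\<in>S. ennreal (V (Suc n) \<omega> / P (Suc n) + c n \<omega> / P (Suc n)) \<partial>M)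
      = ennreal (1 / P (Suc n)) * (\<integral>\<^sup>+\<omega>\<in>S. ennreal (V (Suc n) \<omega> + c n \<omega>) \<partial>M)"
      unfolding add_divide_distrib[symmetric] by (rule scale) (use V0 c0 in auto)
    also have "\<dots> \<le> ennreal (1 / P (Suc n)) * (\<integral>\<^sup>+\<omega>\<in>S. ennreal ((1 + a n) * V n \<omega> + b n \<omega>) \<partial>M)"
      by (intro mult_left_mono step S) simp
    also have "\<dots> = (\<integral>\<^sup>+\<omega>\<in>S. ennreal (((1 + a n) * V n \<omega> + b n \<omega>) / P (Suc n)) \<partial>M)"
      by (rule scale[symmetric]) (use V0 b0 a0 in auto)
    also have "(\<lambda>\<omega>. ((1 + a n) * V n \<omega> + b n \<omega>) / P (Suc n)) = (\<lambda>\<omega>. V n \<omega> / P n + b n \<omega> / P (Suc n))"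
    proof
      fix \<omega>
      have "1 + a n \<noteq> 0" using a0[of n] by linarith
      then show "((1 + a n) * V n \<omega> + b n \<omega>) / P (Suc n) = V n \<omega> / P n + b n \<omega> / P (Suc n)"
        by (simp add: PSuc add_divide_distrib)
    qed
    finally show "(\<integral>\<^sup>+\<omega>\<in>S. ennreal (V (Suc n) \<omega> / P (Suc n) + c n \<omega> / P (Suc n)) \<partial>M)
      \<le> (\<integral>\<^sup>+\<omega>\<in>S. ennreal (V n \<omega> / P n + b n \<omega> / P (Suc n)) \<partial>M)" .
  qed (use V0 b0 c0 P0 in \<open>auto intro!: divide_nonneg_pos\<close>)
  then show ?thesis
  proof eventually_elim
    case (elim \<omega>)
    have "convergent (\<lambda>n. V n \<omega> / P n * P n)"
      using elim P_conv by (intro convergent_mult) auto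
    then have "convergent (\<lambda>n. V n \<omega>)"
      using P0 by (simp add: less_imp_neq[symmetric])
    moreover have "summable (\<lambda>n. exp (suminf a) * (c n \<omega> / P (Suc n)))"
      using elim by (intro summable_mult) auto
    then have "summable (\<lambda>n. c n \<omega>)"
    proof (rule summable_comparison_test[rotated], intro exI allI impI)
      fix n
      have "c n \<omega> * P (Suc n) \<le> c n \<omega> * exp (suminf a)"
        using P_le c0 by (intro mult_left_mono)
      then show "norm (c n \<omega>) \<le> exp (suminf a) * (c n \<omega> / P (Suc n))"
        using P0[of "Suc n"] c0[of n \<omega>] by (simp add: field_simps)
    qed
    ultimately show ?case by blast
  qed
qed
end

section \<open>Martingale differences in Hilbert space\<close>

context prob_space
begin

text \<open>For a simple \<open>h\<close> the integral is a finite sum of inner products of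
  constants with integrals of \<open>d\<close> over sets of \<open>N\<close>, all of which vanish.
  Bounded \<open>h\<close> follow by dominated convergence.\<close>

lemma integral_inner_eq_0:
  fixes h d :: "'a \<Rightarrow> 'b::{real_inner, banach, second_countable_topology}"
  assumes sub: "subalgebra M N"
    and d [measurable]: "integrable M d"
    and zero: "\<And>S. S \<in> sets N \<Longrightarrow> (LINT \<omega>:S|M. d \<omega>) = 0"
    and h: "h \<in> borel_measurable N" and bound: "\<And>\<omega>. \<omega> \<in> space M \<Longrightarrow> norm (h \<omega>) \<le> K"
  shows "(\<integral>\<omega>. inner (h \<omega>) (d \<omega>) \<partial>M) = 0"
proof -
  have spN: "space N = space M" and sub': "sets N \<subseteq> sets M"
    using sub by (auto simp: subalgebra_def)
  \<comment> \<open>The approximation is centred at 0; its factor 2 yields the dominating function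
    \<open>2 * K * norm (d \<omega>)\<close> used below.\<close>
  obtain f where f: "\<And>i. simple_function N (f i)"
      "\<And>\<omega>. \<omega> \<in> space M \<Longrightarrow> (\<lambda>i. f i \<omega>) \<longlonglongrightarrow> h \<omega>"
      "\<And>i \<omega>. \<omega> \<in> space M \<Longrightarrow> norm (f i \<omega>) \<le> 2 * norm (h \<omega>)"
    using borel_measurable_implies_sequence_metric[OF h, of 0] unfolding spN by simp metis
  have [measurable]: "f i \<in> borel_measurable M" for i
    using f(1) by (intro measurable_from_subalg[OF sub] borel_measurable_simple_function)
  have [measurable]: "h \<in> borel_measurable M"
    using h by (rule measurable_from_subalg[OF sub])
  have f_zero: "(\<integral>\<omega>. inner (f i \<omega>) (d \<omega>) \<partial>M) = 0" for i
  proof -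
    let ?A = "\<lambda>v. f i -` {v} \<inter> space M"
    have fin: "finite (f i ` space M)"
      using f(1)[of i] spN by (simp add: simple_function_def)
    have A: "?A v \<in> sets N" for v
      using f(1)[of i, THEN borel_measurable_simple_function] measurable_sets[of "f i" N borel "{v}"] spN by simp
    have int: "integrable M (\<lambda>\<omega>. indicator (?A v) \<omega> *\<^sub>R d \<omega>)" for v
      using A sub' by (intro integrable_mult_indicator d) auto
    have "(\<integral>\<omega>. inner (f i \<omega>) (d \<omega>) \<partial>M) = (\<integral>\<omega>. (\<Sum>v\<in>f i ` space M. inner v (indicator (?A v) \<omega> *\<^sub>R d \<omega>)) \<partial>M)"
    proof (rule Bochner_Integration.integral_cong)
      fix \<omega> assume \<omega>: "\<omega> \<in> space M"
      have "(\<Sum>v\<in>f i ` space M. inner v (indicator (?A v) \<omega> *\<^sub>R d \<omega>))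
        = (\<Sum>v\<in>{f i \<omega>}. inner v (indicator (?A v) \<omega> *\<^sub>R d \<omega>))"
        using \<omega> fin by (intro sum.mono_neutral_right) auto
      also have "\<dots> = inner (f i \<omega>) (d \<omega>)" using \<omega> by simp
      finally show "inner (f i \<omega>) (d \<omega>) = (\<Sum>v\<in>f i ` space M. inner v (indicator (?A v) \<omega> *\<^sub>R d \<omega>))" ..
    qed simp
    also have "\<dots> = (\<Sum>v\<in>f i ` space M. \<integral>\<omega>. inner v (indicator (?A v) \<omega> *\<^sub>R d \<omega>) \<partial>M)"
      by (intro Bochner_Integration.integral_sum integrable_inner_right int)
    also have "\<dots> = (\<Sum>v\<in>f i ` space M. inner v (\<integral>\<omega>. indicator (?A v) \<omega> *\<^sub>R d \<omega> \<partial>M))"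
      by (simp only: integral_inner_right[OF int])
    also have "\<dots> = 0"
      using zero[OF A] by (simp add: set_lebesgue_integral_def)
    finally show ?thesis .
  qed
  have "(\<lambda>i. \<integral>\<omega>. inner (f i \<omega>) (d \<omega>) \<partial>M) \<longlonglongrightarrow> (\<integral>\<omega>. inner (h \<omega>) (d \<omega>) \<partial>M)"
  proof (rule integral_dominated_convergence[where w="\<lambda>\<omega>. 2 * K * norm (d \<omega>)"])
    show "AE \<omega> in M. norm (inner (f i \<omega>) (d \<omega>)) \<le> 2 * K * norm (d \<omega>)" for i
    proof (rule AE_I2)
      fix \<omega> assume \<omega>: "\<omega> \<in> space M"
      have "norm (inner (f i \<omega>) (d \<omega>)) \<le> norm (f i \<omega>) * norm (d \<omega>)"
        by (simp add: Cauchy_Schwarz_ineq2)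
      also have "\<dots> \<le> 2 * K * norm (d \<omega>)"
        using f(3)[OF \<omega>, of i] bound[OF \<omega>] by (intro mult_right_mono) auto
      finally show "norm (inner (f i \<omega>) (d \<omega>)) \<le> 2 * K * norm (d \<omega>)" .
    qed
    show "AE \<omega> in M. (\<lambda>i. inner (f i \<omega>) (d \<omega>)) \<longlonglongrightarrow> inner (h \<omega>) (d \<omega>)"
      using f(2) by (intro AE_I2 tendsto_intros)
  qed (use d in auto)
  then show ?thesis by (simp add: f_zero LIMSEQ_const_iff)
qed

text \<open>\<open>p\<close> and \<open>d\<close> need not be square integrable, so the cross term vanishes only after truncating
  \<open>S\<close> to the sets where \<open>p\<close> is bounded.\<close>

lemma nn_integral_norm_diff_martingale_difference:
  fixes p d :: "'a \<Rightarrow> 'b::{real_inner, banach, second_countable_topology}"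
  assumes sub: "subalgebra M N"
    and d: "integrable M d"
    and zero: "\<And>S. S \<in> sets N \<Longrightarrow> (LINT \<omega>:S|M. d \<omega>) = 0"
    and p: "p \<in> borel_measurable N" and S: "S \<in> sets N"
  shows "(\<integral>\<^sup>+\<omega>\<in>S. ennreal ((norm (p \<omega> - d \<omega>))\<^sup>2) \<partial>M)
    \<le> (\<integral>\<^sup>+\<omega>\<in>S. ennreal ((norm (p \<omega>))\<^sup>2) \<partial>M) + (\<integral>\<^sup>+\<omega>\<in>S. ennreal ((norm (d \<omega>))\<^sup>2) \<partial>M)"
    (is "?L S \<le> ?R S")
proof -
  have spN: "space N = space M" and sub': "sets N \<subseteq> sets M"
    using sub by (auto simp: subalgebra_def)
  have pM [measurable]: "p \<in> borel_measurable M"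
    using p by (rule measurable_from_subalg[OF sub])
  note [measurable] = borel_measurable_integrable[OF d]
  define T where "T k = S \<inter> {\<omega> \<in> space M. norm (p \<omega>) \<le> real k}" for k
  have T: "T k \<in> sets N" for k
  proof -
    have "{\<omega> \<in> space N. norm (p \<omega>) \<le> real k} \<in> sets N"
      using p by measurable
    then show ?thesis using S spN by (simp add: T_def)
  qed
  have TM [measurable]: "T k \<in> sets M" and SM [measurable]: "S \<in> sets M" for k
    using T S sub' by auto
  \<comment> \<open>If the second integral on the right is infinite, nothing is to be shown.
    Otherwise all three terms of the expanded square are integrable over \<open>T k\<close>, where
    \<open>p\<close> is bounded, and the middle one integrates to 0.\<close>
  have T_bound: "?L (T k) \<le> ?R (T k)" for k
  proof (cases "(\<integral>\<^sup>+\<omega>\<in>T k. ennreal ((norm (d \<omega>))\<^sup>2) \<partial>M) = \<infinity>")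
    case False
    let ?I = "\<lambda>\<omega>. indicator (T k) \<omega> :: real"
    have int_d: "integrable M (\<lambda>\<omega>. ?I \<omega> * (norm (d \<omega>))\<^sup>2)"
    proof (rule integrableI_nonneg)
      have "(\<integral>\<^sup>+\<omega>. ennreal (?I \<omega> * (norm (d \<omega>))\<^sup>2) \<partial>M) = (\<integral>\<^sup>+\<omega>\<in>T k. ennreal ((norm (d \<omega>))\<^sup>2) \<partial>M)"
        by (intro nn_integral_cong) (auto split: split_indicator)
      then show "(\<integral>\<^sup>+\<omega>. ennreal (?I \<omega> * (norm (d \<omega>))\<^sup>2) \<partial>M) < \<infinity>"
        using False by (simp add: less_top)
    qed auto
    have int_p: "integrable M (\<lambda>\<omega>. ?I \<omega> * (norm (p \<omega>))\<^sup>2)"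
      by (rule integrable_const_bound[of _ "(real k)\<^sup>2"])
        (auto simp: T_def abs_mult split: split_indicator intro!: power_mono)
    have bdd: "norm (?I \<omega> *\<^sub>R p \<omega>) \<le> real k" for \<omega>
      by (auto simp: T_def split: split_indicator)
    have pN: "(\<lambda>\<omega>. ?I \<omega> *\<^sub>R p \<omega>) \<in> borel_measurable N"
      using T p by measurable
    have int_pd: "integrable M (\<lambda>\<omega>. inner (?I \<omega> *\<^sub>R p \<omega>) (d \<omega>))"
    proof (rule Bochner_Integration.integrable_bound[where f="\<lambda>\<omega>. real k * norm (d \<omega>)"])
      show "AE \<omega> in M. norm (inner (?I \<omega> *\<^sub>R p \<omega>) (d \<omega>)) \<le> norm (real k * norm (d \<omega>))"
      proof (rule AE_I2)
        fix \<omega>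
        have "norm (inner (?I \<omega> *\<^sub>R p \<omega>) (d \<omega>)) \<le> norm (?I \<omega> *\<^sub>R p \<omega>) * norm (d \<omega>)"
          unfolding real_norm_def by (rule Cauchy_Schwarz_ineq2)
        also have "\<dots> \<le> real k * norm (d \<omega>)"
          using bdd by (intro mult_right_mono) auto
        finally show "norm (inner (?I \<omega> *\<^sub>R p \<omega>) (d \<omega>)) \<le> norm (real k * norm (d \<omega>))" by simp
      qed
    qed (use d in auto)
    have eq: "?I \<omega> * (norm (p \<omega> - d \<omega>))\<^sup>2
        = ?I \<omega> * (norm (p \<omega>))\<^sup>2 - 2 * inner (?I \<omega> *\<^sub>R p \<omega>) (d \<omega>) + ?I \<omega> * (norm (d \<omega>))\<^sup>2" for \<omega>
      by (simp add: power2_norm_eq_inner inner_diff_left inner_diff_right inner_commute algebra_simps)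
    have "?L (T k) = (\<integral>\<^sup>+\<omega>. ennreal (?I \<omega> * (norm (p \<omega> - d \<omega>))\<^sup>2) \<partial>M)"
      by (intro nn_integral_cong) (auto split: split_indicator)
    also have "\<dots> = ennreal (\<integral>\<omega>. ?I \<omega> * (norm (p \<omega> - d \<omega>))\<^sup>2 \<partial>M)"
    proof (rule nn_integral_eq_integral)
      show "integrable M (\<lambda>\<omega>. ?I \<omega> * (norm (p \<omega> - d \<omega>))\<^sup>2)"
        unfolding eq by (intro Bochner_Integration.integrable_add Bochner_Integration.integrable_diff
            integrable_mult_right int_p int_d int_pd)
    qed auto
    also have "(\<integral>\<omega>. ?I \<omega> * (norm (p \<omega> - d \<omega>))\<^sup>2 \<partial>M)
        = (\<integral>\<omega>. ?I \<omega> * (norm (p \<omega>))\<^sup>2 \<partial>M) - 2 * (\<integral>\<omega>. inner (?I \<omega> *\<^sub>R p \<omega>) (d \<omega>) \<partial>M)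
          + (\<integral>\<omega>. ?I \<omega> * (norm (d \<omega>))\<^sup>2 \<partial>M)"
      unfolding eq using int_p int_d int_pd by simp
    also have "(\<integral>\<omega>. inner (?I \<omega> *\<^sub>R p \<omega>) (d \<omega>) \<partial>M) = 0"
      by (rule integral_inner_eq_0[OF sub d zero pN bdd])
    also have "ennreal ((\<integral>\<omega>. ?I \<omega> * (norm (p \<omega>))\<^sup>2 \<partial>M) - 2 * 0 + (\<integral>\<omega>. ?I \<omega> * (norm (d \<omega>))\<^sup>2 \<partial>M))
        = (\<integral>\<^sup>+\<omega>. ennreal (?I \<omega> * (norm (p \<omega>))\<^sup>2) \<partial>M) + (\<integral>\<^sup>+\<omega>. ennreal (?I \<omega> * (norm (d \<omega>))\<^sup>2) \<partial>M)"
      using int_p int_d by (simp add: nn_integral_eq_integral ennreal_plus integral_nonneg_AE)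
    also have "\<dots> = ?R (T k)"
      by (intro arg_cong2[where f="(+)"] nn_integral_cong) (auto split: split_indicator)
    finally show ?thesis by simp
  qed simp
  have S_space: "S \<subseteq> space M" using sets.sets_into_space[OF SM] .
  have UT: "(\<Union>k. T k) = S"
    using S_space by (auto simp: T_def intro: real_arch_simple)
  have "incseq T" by (auto simp: T_def incseq_def)
  have "?L S = (\<integral>\<^sup>+\<omega>. (SUP k. ennreal ((norm (p \<omega> - d \<omega>))\<^sup>2) * indicator (T k) \<omega>) \<partial>M)"
  proof (intro nn_integral_cong)
    fix \<omega>
    show "ennreal ((norm (p \<omega> - d \<omega>))\<^sup>2) * indicator S \<omega> = (SUP k. ennreal ((norm (p \<omega> - d \<omega>))\<^sup>2) * indicator (T k) \<omega>)"
      (is "?l = (SUP k. ?r k)")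
    proof (rule antisym)
      show "?l \<le> (SUP k. ?r k)"
      proof (cases "\<omega> \<in> S")
        case True
        then obtain k where "\<omega> \<in> T k" using UT by blast
        then have "?l = ?r k" using True by simp
        also have "\<dots> \<le> (SUP k. ?r k)" by (rule SUP_upper) simp
        finally show ?thesis .
      qed simp
      show "(SUP k. ?r k) \<le> ?l"
        by (rule SUP_least) (auto simp: T_def split: split_indicator)
    qed
  qed
  also have "\<dots> = (SUP k. ?L (T k))"
    using \<open>incseq T\<close> by (intro nn_integral_monotone_convergence_SUP)
      (auto simp: incseq_def le_fun_def split: split_indicator)
  also have "\<dots> \<le> ?R S"
  proof (rule SUP_least)
    fix k
    have "?R (T k) \<le> ?R S"
      by (intro add_mono nn_integral_mono) (auto simp: T_def split: split_indicator)
    then show "?L (T k) \<le> ?R S" using T_bound[of k] by simp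
  qed
  finally show ?thesis .
qed

end

section \<open>Weak convergence in Hilbert space\<close>

text \<open>The representing vector is the minimiser of \<open>g v = (norm v)^2 - 2 * l v\<close>.
  The parallelogram law makes minimising sequences Cauchy, completeness supplies the minimiser, and
  its first variation in direction \<open>v\<close> is \<open>inner p v - l v\<close> up to a
  factor.\<close>

lemma riesz_representation:
  fixes l :: "'a::{real_inner, banach} \<Rightarrow> real"
  assumes "bounded_linear l"
  obtains p where "\<And>v. l v = inner p v"
proof -
  interpret l: bounded_linear l by fact
  define g where "g v = (norm v)\<^sup>2 - 2 * l v" for v
  obtain K where K: "\<And>v. norm (l v) \<le> norm v * K" using l.bounded by blast
  have g_low: "- (K\<^sup>2) \<le> g v" for v
  proof -
    have "2 * l v \<le> 2 * (norm v * K)" using K[of v] by simp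
    also have "\<dots> \<le> (norm v)\<^sup>2 + K\<^sup>2" using sum_squares_bound[of "norm v" K] by simp
    finally show ?thesis by (simp add: g_def)
  qed
  define m where "m = Inf (range g)"
  have bdd: "bdd_below (range g)" using g_low by (intro bdd_belowI[of _ "- (K\<^sup>2)"]) auto
  have m_le: "m \<le> g v" for v unfolding m_def using bdd by (intro cInf_lower) auto
  have "\<exists>v. g v < m + inverse (real (Suc n))" for n
    using cInf_less_iff[OF _ bdd, of "m + inverse (real (Suc n))"] by (auto simp: m_def)
  then obtain v where v: "\<And>n. g (v n) < m + inverse (real (Suc n))" by metis
  \<comment> \<open>Evaluating \<open>g\<close> at the midpoint \<open>h\<close> and using that
    \<open>m\<close> is a lower bound there controls the distance of two near-minimisers.\<close>
  have parallelogram: "(norm (u - v))\<^sup>2 \<le> 2 * (g u - m) + 2 * (g v - m)" for u v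
  proof -
    define h where "h = (1/2) *\<^sub>R (u + v)"
    have "4 * g h = (norm (u + v))\<^sup>2 - 4 * (l u + l v)"
      by (simp add: h_def g_def l.scaleR l.add power_divide) (simp add: add_divide_distrib)
    moreover have "(norm (u - v))\<^sup>2 + (norm (u + v))\<^sup>2 = 2 * (norm u)\<^sup>2 + 2 * (norm v)\<^sup>2"
      by (simp add: power2_norm_eq_inner inner_add inner_diff inner_commute)
    ultimately have "(norm (u - v))\<^sup>2 = 2 * g u + 2 * g v - 4 * g h"
      by (simp add: g_def)
    then show ?thesis using m_le[of h] by simp
  qed
  have "Cauchy v"
  proof (rule CauchyI)
    fix e :: real assume "0 < e"
    then obtain N where N: "inverse (real (Suc N)) < e\<^sup>2 / 4"
      using reals_Archimedean[of "e\<^sup>2 / 4"] by auto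
    have near: "g (v k) - m < e\<^sup>2 / 4" if "k \<ge> N" for k
    proof -
      have "inverse (real (Suc k)) \<le> inverse (real (Suc N))"
        using that by (simp add: field_simps)
      then have "inverse (real (Suc k)) < e\<^sup>2 / 4" using N by (rule order_le_less_trans)
      then have "m + inverse (real (Suc k)) < m + e\<^sup>2 / 4" by (rule add_strict_left_mono)
      with v[of k] have "g (v k) < m + e\<^sup>2 / 4" by (rule order_less_trans)
      then show ?thesis by simp
    qed
    have "norm (v i - v j) < e" if "i \<ge> N" "j \<ge> N" for i j
    proof -
      have "g (v i) - m < e\<^sup>2 / 4" "g (v j) - m < e\<^sup>2 / 4"
        using near that by auto
      then have "2 * (g (v i) - m) + 2 * (g (v j) - m) < 2 * (e\<^sup>2 / 4) + 2 * (e\<^sup>2 / 4)"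
        by (intro add_strict_mono mult_strict_left_mono) auto
      then have "(norm (v i - v j))\<^sup>2 < e\<^sup>2"
        using parallelogram[of "v i" "v j"] by simp
      then show ?thesis using \<open>0 < e\<close> by (simp add: power2_less_imp_less)
    qed
    then show "\<exists>N. \<forall>i\<ge>N. \<forall>j\<ge>N. norm (v i - v j) < e" by blast
  qed
  then obtain p where p: "v \<longlonglongrightarrow> p" using Cauchy_convergent convergent_def by blast
  have "(\<lambda>n. g (v n)) \<longlonglongrightarrow> g p"
    unfolding g_def by (intro tendsto_intros l.tendsto p)
  moreover have "(\<lambda>n. m + inverse (real (Suc n))) \<longlonglongrightarrow> m"
    using tendsto_add[OF tendsto_const LIMSEQ_inverse_real_of_nat] by simp
  ultimately have gp: "g p \<le> m"
    using v by (intro LIMSEQ_le) (auto intro: less_imp_le)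
  have "l v = inner p v" for v
  proof (cases "v = 0")
    case False
    define c where "c = inner p v - l v"
    \<comment> \<open>The minimiser of the quadratic \<open>t^2 * (norm v)^2 + 2 * t * c\<close> in
      \<open>t\<close>; its value there is negative unless \<open>c = 0\<close>.\<close>
    define t where "t = - c / (norm v)\<^sup>2"
    have "(norm (p + t *\<^sub>R v))\<^sup>2 = (norm p)\<^sup>2 + 2 * t * inner p v + t\<^sup>2 * (norm v)\<^sup>2"
      unfolding power2_norm_eq_inner
      by (simp add: inner_add inner_commute[of v p] power2_eq_square distrib_left)
    then have "g (p + t *\<^sub>R v) = g p + t\<^sup>2 * (norm v)\<^sup>2 + 2 * t * c"
      by (simp add: g_def c_def l.scaleR l.add algebra_simps)
    then have "0 \<le> t\<^sup>2 * (norm v)\<^sup>2 + 2 * t * c"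
      using m_le[of "p + t *\<^sub>R v"] gp by linarith
    also have "\<dots> = - (c\<^sup>2 / (norm v)\<^sup>2)"
      using False by (simp add: t_def field_simps power2_eq_square)
    finally have "c\<^sup>2 / (norm v)\<^sup>2 \<le> 0" by simp
    then have "c = 0" using False by (simp add: divide_le_0_iff)
    then show ?thesis by (simp add: c_def)
  qed simp
  then show thesis by (rule that)
qed

lemma weakly_converges_subseq:
  "weakly_converges f l \<Longrightarrow> strict_mono r \<Longrightarrow> weakly_converges (f \<circ> r) l"
  unfolding weakly_converges_def o_def
  using LIMSEQ_subseq_LIMSEQ[unfolded o_def] by blast

lemma weakly_converges_add_null:
  assumes "weakly_converges f l" "(\<lambda>n. g n - f n) \<longlonglongrightarrow> 0"
  shows "weakly_converges g l"
  unfolding weakly_converges_def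
proof
  fix v
  have "(\<lambda>n. inner (f n) v + inner (g n - f n) v) \<longlonglongrightarrow> inner l v + inner 0 v"
    using assms(1) unfolding weakly_converges_def
    by (intro tendsto_add tendsto_inner[OF assms(2) tendsto_const]) auto
  then show "(\<lambda>n. inner (g n) v) \<longlonglongrightarrow> inner l v"
    by (simp add: inner_add_left[symmetric])
qed

text \<open>A diagonal subsequence makes the inner products with a countable dense set converge. The
  common norm bound extends this to every vector, and the limit is a bounded linear functional,
  hence an inner product with some \<open>p\<close>.\<close>

lemma bounded_imp_weakly_convergent_subseq:
  fixes f :: "nat \<Rightarrow> 'a::{real_inner, banach, second_countable_topology}"
  assumes "bounded (range f)"
  obtains r p where "strict_mono r" "weakly_converges (f \<circ> r) p"
proof -
  obtain K where K: "\<And>n. norm (f n) \<le> K" and K0: "0 < K"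
    using assms unfolding bounded_pos by auto
  have inner_le: "norm (inner (f k) v) \<le> K * norm v" for k v
    using order_trans[OF Cauchy_Schwarz_ineq2 mult_right_mono[OF K norm_ge_zero]] by simp
  obtain D :: "'a set" where "countable D" and D: "\<And>X. open X \<Longrightarrow> X \<noteq> {} \<Longrightarrow> \<exists>d\<in>D. d \<in> X"
    by (erule countable_dense_setE)
  define q where "q = from_nat_into D"
  have D_ne: "D \<noteq> {}" using D[of UNIV] by auto
  interpret subseqs "\<lambda>n s. convergent (\<lambda>k. inner (f (s k)) (q n))"
  proof
    fix n and t :: "nat \<Rightarrow> nat"
    have "bounded (range (\<lambda>k. inner (f (t k)) (q n)))"
      unfolding bounded_iff using inner_le by blast
    then obtain a r' where "strict_mono r'" "((\<lambda>k. inner (f (t k)) (q n)) \<circ> r') \<longlonglongrightarrow> a"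
      using bounded_imp_convergent_subsequence by metis
    then show "\<exists>r'. strict_mono r' \<and> convergent (\<lambda>k. inner (f ((t \<circ> r') k)) (q n))"
      by (auto simp: o_def convergent_def)
  qed
  have conv_q: "convergent (\<lambda>k. inner (f (diagseq k)) (q n))" for n
  proof -
    \<comment> \<open>Only the tail of the diagonal sequence beyond index \<open>n\<close> is a
      subsequence of the n-th extraction, so the shift by \<open>Suc n\<close> is inserted here and
      removed afterwards.\<close>
    have "convergent (\<lambda>k. inner (f ((diagseq \<circ> (+) (Suc n)) k)) (q n))"
    proof (rule diagseq_holds)
      fix r s :: "nat \<Rightarrow> nat" and n
      assume "strict_mono r" "convergent (\<lambda>k. inner (f (s k)) (q n))"
      from convergent_subseq_convergent[OF this(2,1)]
      show "convergent (\<lambda>k. inner (f ((s \<circ> r) k)) (q n))" by (simp add: o_def)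
    qed
    then have "convergent (\<lambda>k. inner (f (diagseq (k + Suc n))) (q n))"
      by (simp add: o_def add.commute)
    then show ?thesis by (subst (asm) convergent_ignore_initial_segment)
  qed
  have conv: "convergent (\<lambda>k. inner (f (diagseq k)) v)" for v
  proof -
    have "Cauchy (\<lambda>k. inner (f (diagseq k)) v)"
    proof (rule CauchyI)
      fix e :: real assume e: "0 < e"
      have "0 < e / (3 * K)" using e K0 by simp
      then have "ball v (e / (3 * K)) \<noteq> {}" by (metis centre_in_ball empty_iff)
      then obtain d where "d \<in> D" "d \<in> ball v (e / (3 * K))"
        using D open_ball by blast
      then obtain n where n: "norm (v - q n) < e / (3 * K)"
        using from_nat_into_surj[OF \<open>countable D\<close>] by (metis dist_norm mem_ball q_def)
      have near: "\<bar>inner (f k) v - inner (f k) (q n)\<bar> < e / 3" for k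
      proof -
        have "\<bar>inner (f k) v - inner (f k) (q n)\<bar> \<le> norm (f k) * norm (v - q n)"
          by (simp add: inner_diff_right[symmetric] Cauchy_Schwarz_ineq2)
        also have "\<dots> \<le> K * norm (v - q n)" by (intro mult_right_mono K) simp
        also have "\<dots> < e / 3" using n K0 by (simp add: field_simps)
        finally show ?thesis .
      qed
      obtain N where N: "\<And>i j. i \<ge> N \<Longrightarrow> j \<ge> N \<Longrightarrow>
          norm (inner (f (diagseq i)) (q n) - inner (f (diagseq j)) (q n)) < e / 3"
        using CauchyD[OF convergent_Cauchy[OF conv_q[of n]], of "e / 3"] e by auto
      have "norm (inner (f (diagseq i)) v - inner (f (diagseq j)) v) < e" if "i \<ge> N" "j \<ge> N" for i j
        using N[OF that] near[of "diagseq i"] near[of "diagseq j"] unfolding real_norm_def by linarith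
      then show "\<exists>N. \<forall>i\<ge>N. \<forall>j\<ge>N. norm (inner (f (diagseq i)) v - inner (f (diagseq j)) v) < e"
        by blast
    qed
    then show ?thesis by (rule Cauchy_convergent)
  qed
  define l where "l v = lim (\<lambda>k. inner (f (diagseq k)) v)" for v
  have l: "(\<lambda>k. inner (f (diagseq k)) v) \<longlonglongrightarrow> l v" for v
    using conv[of v] unfolding l_def by (simp add: convergent_LIMSEQ_iff)
  have "bounded_linear l"
  proof (rule bounded_linear_intro)
    show "l (u + v) = l u + l v" for u v
      using LIMSEQ_unique[OF l[of "u + v"]] tendsto_add[OF l l] by (simp add: inner_add_right)
    show "l (c *\<^sub>R v) = c *\<^sub>R l v" for c v
      using LIMSEQ_unique[OF l[of "c *\<^sub>R v"]] tendsto_mult[OF tendsto_const l] by simp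
    show "norm (l v) \<le> norm v * K" for v
    proof (rule LIMSEQ_le_const2[OF tendsto_norm[OF l]])
      show "\<exists>N. \<forall>k\<ge>N. norm (inner (f (diagseq k)) v) \<le> norm v * K"
        using inner_le by (simp add: mult.commute)
    qed
  qed
  then obtain p where "\<And>v. l v = inner p v" using riesz_representation by blast
  then have "weakly_converges (f \<circ> diagseq) p"
    using l unfolding weakly_converges_def by simp
  then show thesis using that subseq_diagseq by blast
qed

text \<open>The difference of the squared distances of \<open>f n\<close> to two weak cluster points
  converges, and it is affine in \<open>f n\<close> because the quadratic terms cancel. Its limit
  along both subsequences must agree, which forces the cluster points to coincide.\<close>

lemma opial:
  fixes f :: "nat \<Rightarrow> 'a::{real_inner, banach, second_countable_topology}"
  assumes "Z \<noteq> {}"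
    and conv: "\<And>z. z \<in> Z \<Longrightarrow> convergent (\<lambda>n. norm (f n - z))"
    and cluster: "\<And>r p. strict_mono r \<Longrightarrow> weakly_converges (f \<circ> r) p \<Longrightarrow> p \<in> Z"
  obtains p where "p \<in> Z" "weakly_converges f p"
proof -
  obtain z where "z \<in> Z" using assms(1) by blast
  then obtain K where K: "\<And>n. norm (f n - z) \<le> K"
    using convergent_imp_Bseq[OF conv] unfolding Bseq_def by fastforce
  have "norm (f n) \<le> K + norm z" for n
    using K[of n] norm_triangle_sub[of "f n" z] by linarith
  then have bdd: "bounded (range f)" unfolding bounded_iff by blast
  then obtain r p where r: "strict_mono r" and p: "weakly_converges (f \<circ> r) p"
    by (rule bounded_imp_weakly_convergent_subseq)
  then have pZ: "p \<in> Z" by (rule cluster)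
  have unique: "p' = p" if r': "strict_mono r'" and p': "weakly_converges (f \<circ> r') p'" for r' p'
  proof -
    have "p' \<in> Z" using r' p' by (rule cluster)
    obtain a a' where "(\<lambda>n. norm (f n - p)) \<longlonglongrightarrow> a" "(\<lambda>n. norm (f n - p')) \<longlonglongrightarrow> a'"
      using conv[OF pZ] conv[OF \<open>p' \<in> Z\<close>] unfolding convergent_def by blast
    then have c: "(\<lambda>n. (norm (f n - p))\<^sup>2 - (norm (f n - p'))\<^sup>2) \<longlonglongrightarrow> a\<^sup>2 - a'\<^sup>2"
      by (intro tendsto_intros)
    have eq: "(norm (f n - p))\<^sup>2 - (norm (f n - p'))\<^sup>2
        = 2 * inner (f n) (p' - p) + ((norm p)\<^sup>2 - (norm p')\<^sup>2)" for n
      by (simp add: power2_norm_eq_inner inner_diff inner_commute algebra_simps)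
    have lim: "2 * inner b (p' - p) + ((norm p)\<^sup>2 - (norm p')\<^sup>2) = a\<^sup>2 - a'\<^sup>2"
      if "strict_mono t" "weakly_converges (f \<circ> t) b" for t b
    proof (rule LIMSEQ_unique)
      show "(\<lambda>n. (norm (f (t n) - p))\<^sup>2 - (norm (f (t n) - p'))\<^sup>2) \<longlonglongrightarrow> a\<^sup>2 - a'\<^sup>2"
        using LIMSEQ_subseq_LIMSEQ[OF c that(1)] by (simp add: o_def)
      show "(\<lambda>n. (norm (f (t n) - p))\<^sup>2 - (norm (f (t n) - p'))\<^sup>2)
        \<longlonglongrightarrow> 2 * inner b (p' - p) + ((norm p)\<^sup>2 - (norm p')\<^sup>2)"
        unfolding eq using that(2) unfolding weakly_converges_def
        by (intro tendsto_add tendsto_mult tendsto_const) (auto simp: o_def)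
    qed
    have "inner p (p' - p) = inner p' (p' - p)"
      using lim[OF r p] lim[OF r' p'] by simp
    then have "inner (p' - p) (p' - p) = 0"
      by (simp only: inner_diff_left diff_self)
    then show ?thesis by simp
  qed
  have "weakly_converges f p"
    unfolding weakly_converges_def
  proof
    fix v
    show "(\<lambda>n. inner (f n) v) \<longlonglongrightarrow> inner p v"
    proof (rule ccontr)
      \<comment> \<open>Subsequence principle: a subsequence staying \<open>e\<close> away from the
        limit is still bounded, so it has a weakly convergent subsequence, whose limit must be
        \<open>p\<close>.\<close>
      assume "\<not> ?thesis"
      then obtain e where e: "0 < e" and "\<exists>\<^sub>F n in sequentially. e \<le> dist (inner (f n) v) (inner p v)"
        unfolding tendsto_iff by (auto simp: not_eventually not_less)
      then have inf: "infinite {n. e \<le> dist (inner (f n) v) (inner p v)}"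
        by (simp add: cofinite_eq_sequentially[symmetric] frequently_cofinite)
      define t where "t = enumerate {n. e \<le> dist (inner (f n) v) (inner p v)}"
      have t: "strict_mono t"
        unfolding t_def using inf by (rule strict_mono_enumerate)
      have far: "e \<le> dist (inner (f (t n)) v) (inner p v)" for n
        using enumerate_in_set[OF inf, of n] by (simp add: t_def)
      have "bounded (range (f \<circ> t))" using bdd by (rule bounded_subset) auto
      then obtain r' p' where r': "strict_mono r'" "weakly_converges ((f \<circ> t) \<circ> r') p'"
        by (rule bounded_imp_weakly_convergent_subseq)
      then have "p' = p"
        using t by (intro unique[of "t \<circ> r'"]) (auto simp: strict_mono_o o_assoc)
      then have "(\<lambda>n. inner (f (t (r' n))) v) \<longlonglongrightarrow> inner p v"
        using r'(2) unfolding weakly_converges_def by simp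
      then have "\<forall>\<^sub>F n in sequentially. dist (inner (f (t (r' n))) v) (inner p v) < e"
        using e by (rule tendstoD)
      then show False using far by (auto simp: eventually_sequentially not_less[symmetric])
    qed
  qed
  with pZ show thesis by (rule that)
qed

text \<open>Pettis' theorem for a separable space: the norm is determined by countably many inner
  products, so preimages of closed balls are measurable, and every open set is a countable union of
  balls with centres in a dense set and rational radii.\<close>

lemma borel_measurable_weakly:
  fixes f :: "'w \<Rightarrow> 'a::{real_inner, second_countable_topology}"
  assumes weak: "\<And>v. (\<lambda>\<omega>. inner (f \<omega>) v) \<in> borel_measurable M"
  shows "f \<in> borel_measurable M"
proof (rule borel_measurableI)
  fix U :: "'a set" assume U: "open U"
  obtain D :: "'a set" where cD: "countable D" and D: "\<And>X. open X \<Longrightarrow> X \<noteq> {} \<Longrightarrow> \<exists>d\<in>D. d \<in> X"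
    by (erule countable_dense_setE)
  \<comment> \<open>The condition on \<open>d\<close> is closed, so it extends from \<open>D\<close>
    to all vectors; testing it with \<open>d = a\<close> gives the norm bound.\<close>
  have norm_le: "norm a \<le> e \<longleftrightarrow> (\<forall>d\<in>D. inner a d \<le> e * norm d)" if "0 < e" for a :: 'a and e
  proof
    assume "norm a \<le> e"
    show "\<forall>d\<in>D. inner a d \<le> e * norm d"
      using norm_cauchy_schwarz[of a] mult_right_mono[OF \<open>norm a \<le> e\<close> norm_ge_zero]
      by (meson order_trans)
  next
    assume *: "\<forall>d\<in>D. inner a d \<le> e * norm d"
    have "closed {d. inner a d \<le> e * norm d}"
      by (intro closed_Collect_le continuous_intros)
    moreover have "\<not> (\<exists>d\<in>D. d \<in> - {d. inner a d \<le> e * norm d})" using * by auto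
    ultimately have "- {d. inner a d \<le> e * norm d} = {}"
      using D[of "- {d. inner a d \<le> e * norm d}"] by auto
    then have "inner a a \<le> e * norm a" by auto
    then show "norm a \<le> e"
      using \<open>0 < e\<close> by (cases "a = 0")
        (auto simp: power2_norm_eq_inner[symmetric] power2_eq_square mult_le_cancel_right)
  qed
  have ball_meas: "{\<omega>\<in>space M. norm (f \<omega> - c) \<le> e} \<in> sets M" if "0 < e" for c e
  proof -
    have [measurable]: "(\<lambda>\<omega>. inner (f \<omega> - c) d) \<in> borel_measurable M" for d
      unfolding inner_diff_left by (intro borel_measurable_diff weak) simp
    have "{\<omega>\<in>space M. \<forall>d\<in>D. inner (f \<omega> - c) d \<le> e * norm d} \<in> sets M"
      using cD by measurable
    then show ?thesis by (simp add: norm_le[OF that])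
  qed
  define I where "I = {(d, q). d \<in> D \<and> q \<in> \<rat> \<and> 0 < q \<and> cball d q \<subseteq> U}"
  have "countable I"
    by (rule countable_subset[of _ "D \<times> \<rat>"]) (auto simp: I_def cD countable_rat)
  have U_eq: "U = (\<Union>(d, q)\<in>I. cball d q)"
  proof (intro equalityI subsetI)
    fix a assume "a \<in> U"
    then obtain e where e: "0 < e" "ball a e \<subseteq> U" using U open_contains_ball by blast
    obtain q where q: "q \<in> \<rat>" "0 < q" "q < e / 2" using Rats_dense_in_real[of 0 "e/2"] e by auto
    obtain d where d: "d \<in> D" "d \<in> ball a q" using D[of "ball a q"] q by auto
    have "cball d q \<subseteq> ball a e"
    proof
      fix b assume "b \<in> cball d q"
      then show "b \<in> ball a e"
        using d(2) q(3) dist_triangle[of a b d] by (simp add: dist_commute)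
    qed
    then have "(d, q) \<in> I" using d q e by (auto simp: I_def)
    moreover have "a \<in> cball d q" using d(2) by (simp add: dist_commute)
    ultimately show "a \<in> (\<Union>(d, q)\<in>I. cball d q)" by blast
  qed (auto simp: I_def)
  have "f -` U \<inter> space M = (\<Union>(d, q)\<in>I. {\<omega>\<in>space M. norm (f \<omega> - d) \<le> q})"
    unfolding U_eq by (force simp: dist_norm norm_minus_commute)
  also have "\<dots> \<in> sets M"
    using \<open>countable I\<close> by (intro sets.countable_UN') (auto simp: I_def intro!: ball_meas)
  finally show "f -` U \<inter> space M \<in> sets M" .
qed

section \<open>Monotone operators\<close>

lemma zeros_iff: "z \<in> op_inv (op_add A (\<lambda>z. {B z})) 0 \<longleftrightarrow> - B z \<in> A z"
  unfolding op_inv_def op_add_def by (auto simp: add_eq_0_iff2)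

lemma resolvent_scale_iff:
  assumes "c \<noteq> 0"
  shows "y \<in> resolvent (op_scale c A) v \<longleftrightarrow> (1 / c) *\<^sub>R (v - y) \<in> A y"
proof -
  have "v = y + c *\<^sub>R u \<longleftrightarrow> u = (1 / c) *\<^sub>R (v - y)" for u
    using assms by auto
  with assms show ?thesis
    unfolding resolvent_def op_inv_def op_add_def op_scale_def by auto
qed

text \<open>Monotonicity applied to the two inclusions gives firm nonexpansiveness, and
  Cauchy-Schwarz finishes. As arbitrary members of the set-valued resolvent are compared, the case
  \<open>v = v'\<close> also yields single-valuedness.\<close>

lemma resolvent_nonexpansive:
  assumes mono: "monotone_op A" and c: "0 < c"
    and y: "y \<in> resolvent (op_scale c A) v" and y': "y' \<in> resolvent (op_scale c A) v'"
  shows "norm (y - y') \<le> norm (v - v')"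
proof -
  have "0 \<le> inner (y - y') ((1 / c) *\<^sub>R (v - y) - (1 / c) *\<^sub>R (v' - y'))"
    using mono y y' c unfolding monotone_op_def by (auto simp: resolvent_scale_iff)
  also have "\<dots> = (1 / c) * (inner (y - y') (v - v') - (norm (y - y'))\<^sup>2)"
    by (simp add: power2_norm_eq_inner inner_diff algebra_simps)
  finally have "(norm (y - y'))\<^sup>2 \<le> inner (y - y') (v - v')"
    using c by (simp add: zero_le_divide_iff)
  also have "\<dots> \<le> norm (y - y') * norm (v - v')" by (rule norm_cauchy_schwarz)
  finally show ?thesis
    by (cases "y = y'") (auto simp: power2_eq_square mult_le_cancel_left)
qed

text \<open>On the set \<open>D\<close> of points with nonempty resolvent a selection
  \<open>J\<close> is 1-Lipschitz, hence Borel on the trace space of \<open>D\<close>. The function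
  \<open>v\<close> takes its values in \<open>D\<close>, and single-valuedness identifies
  \<open>y\<close> with \<open>J\<close> composed with \<open>v\<close>.\<close>

lemma borel_measurable_resolvent:
  fixes A :: "'a::{real_inner, second_countable_topology} \<Rightarrow> 'a set"
  assumes mono: "monotone_op A" and c: "0 < c"
    and v: "v \<in> borel_measurable N"
    and y: "\<And>\<omega>. \<omega> \<in> space N \<Longrightarrow> y \<omega> \<in> resolvent (op_scale c A) (v \<omega>)"
  shows "y \<in> borel_measurable N"
proof -
  let ?R = "resolvent (op_scale c A)"
  define J where "J a = (SOME b. b \<in> ?R a)" for a
  define D where "D = {a. ?R a \<noteq> {}}"
  have J: "J a \<in> ?R a" if "a \<in> D" for a
    using that unfolding J_def D_def by (auto intro: someI)
  have "1-lipschitz_on D J"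
    using J by (intro lipschitz_onI) (auto simp: dist_norm intro: resolvent_nonexpansive[OF mono c])
  then have "J \<in> borel_measurable (restrict_space borel D)"
    by (intro borel_measurable_continuous_on_restrict lipschitz_on_continuous_on)
  moreover have "v \<in> measurable N (restrict_space borel D)"
    using v y by (intro measurable_restrict_space2) (auto simp: D_def)
  ultimately have "(\<lambda>\<omega>. J (v \<omega>)) \<in> borel_measurable N"
    by (rule measurable_compose[rotated])
  moreover have "y \<omega> = J (v \<omega>)" if "\<omega> \<in> space N" for \<omega>
    using resolvent_nonexpansive[OF mono c y[OF that] J, of "v \<omega>"] y[OF that] by (auto simp: D_def)
  ultimately show ?thesis
    by (simp cong: measurable_cong)
qed

text \<open>Adjoining the single pair \<open>(p, w)\<close> to the graph keeps it monotone, so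
  maximality says the pair was there already.\<close>

lemma maximally_monotone_op_memI:
  assumes max: "maximally_monotone_op A"
    and *: "\<And>a v. v \<in> A a \<Longrightarrow> 0 \<le> inner (p - a) (w - v)"
  shows "w \<in> A p"
proof -
  have mono: "\<And>a b u v. u \<in> A a \<Longrightarrow> v \<in> A b \<Longrightarrow> 0 \<le> inner (a - b) (u - v)"
    using max unfolding maximally_monotone_op_def monotone_op_def by blast
  define S where "S = A(p := insert w (A p))"
  have **: "0 \<le> inner (a - p) (v - w)" if "v \<in> A a" for a v
    using *[OF that] by (simp add: inner_diff algebra_simps)
  have "monotone_op S"
    unfolding monotone_op_def S_def using mono * ** by auto
  moreover have "\<forall>x. A x \<subseteq> S x" by (auto simp: S_def)
  ultimately have "S = A" using max unfolding maximally_monotone_op_def by blast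
  then show ?thesis by (metis S_def fun_upd_same insertI1)
qed

text \<open>The sum is demiclosed at \<open>0\<close> without knowing that it is maximal: along a subsequence with
  \<open>B y\<^sub>n \<rightharpoonup> q\<close>, monotonicity of \<open>B\<close> puts \<open>- q\<close> into \<open>A p\<close>; testing \<open>A\<close> against this new pair then
  gives \<open>\<langle>y\<^sub>n, B y\<^sub>n\<rangle> \<rightarrow> \<langle>p, q\<rangle>\<close>, and Minty's device yields \<open>q = B p\<close>.\<close>

lemma zeros_demiclosed:
  fixes A :: "'a::{real_inner, banach, second_countable_topology} \<Rightarrow> 'a set"
  assumes max: "maximally_monotone_op A"
    and monoB: "monotone_op (\<lambda>z. {B z})"
    and L: "0 < L" "L-lipschitz_on UNIV B"
    and y: "bounded (range y)" "weakly_converges y p"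
    and u: "\<And>n. u n \<in> A (y n)"
    and null: "(\<lambda>n. u n + B (y n)) \<longlonglongrightarrow> 0"
  shows "- B p \<in> A p"
proof -
  have monoA: "\<And>a b u v. u \<in> A a \<Longrightarrow> v \<in> A b \<Longrightarrow> 0 \<le> inner (a - b) (u - v)"
    using max unfolding maximally_monotone_op_def monotone_op_def by blast
  have monoB': "0 \<le> inner (a - b) (B a - B b)" for a b
    using monoB unfolding monotone_op_def by simp
  obtain K where K: "\<And>n. norm (y n) \<le> K" using y(1) unfolding bounded_iff by auto
  have "norm (B (y n)) \<le> L * K + norm (B 0)" for n
  proof -
    have "norm (B (y n) - B 0) \<le> L * norm (y n)"
      using lipschitz_onD[OF L(2), of "y n" 0] by (simp add: dist_norm)
    also have "\<dots> \<le> L * K" using K L(1) by (intro mult_left_mono) auto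
    finally show ?thesis using norm_triangle_sub[of "B (y n)" "B 0"] by linarith
  qed
  then have "bounded (range (\<lambda>n. B (y n)))" unfolding bounded_iff by auto
  then obtain r q where r: "strict_mono r" and q: "weakly_converges ((\<lambda>n. B (y n)) \<circ> r) q"
    by (rule bounded_imp_weakly_convergent_subseq)
  define f where "f n = y (r n)" for n
  define g where "g n = u (r n)" for n
  have fw: "(\<lambda>n. inner (f n) v) \<longlonglongrightarrow> inner p v" for v
    using weakly_converges_subseq[OF y(2) r] unfolding weakly_converges_def f_def by simp
  have Bw: "(\<lambda>n. inner (B (f n)) v) \<longlonglongrightarrow> inner q v" for v
    using q unfolding weakly_converges_def f_def by simp
  have gB: "(\<lambda>n. g n + B (f n)) \<longlonglongrightarrow> 0"
    using LIMSEQ_subseq_LIMSEQ[OF null r] unfolding f_def g_def o_def .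
  have gw: "(\<lambda>n. inner (g n) v) \<longlonglongrightarrow> - inner q v" for v
  proof -
    have "(\<lambda>n. inner (g n + B (f n)) v - inner (B (f n)) v) \<longlonglongrightarrow> inner 0 v - inner q v"
      by (intro tendsto_diff tendsto_inner gB tendsto_const Bw)
    then show ?thesis by (simp add: inner_add_left)
  qed
  have gA: "g n \<in> A (f n)" for n unfolding f_def g_def by (rule u)
  \<comment> \<open>The crucial product: inner products of two weakly convergent sequences need not
    converge, but here a bounded sequence meets a norm-null one. Both inequalities below are
    arranged so that this is the only such product.\<close>
  have fgB: "(\<lambda>n. inner (f n) (g n + B (f n))) \<longlonglongrightarrow> 0"
  proof (rule Lim_null_comparison)
    have "norm (inner (f n) (g n + B (f n))) \<le> K * norm (g n + B (f n))" for n
      using Cauchy_Schwarz_ineq2[of "f n" "g n + B (f n)"] mult_right_mono[OF K[of "r n"] norm_ge_zero[of "g n + B (f n)"]]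
      by (simp add: f_def)
    then show "\<forall>\<^sub>F n in sequentially. norm (inner (f n) (g n + B (f n))) \<le> K * norm (g n + B (f n))"
      by simp
    show "(\<lambda>n. K * norm (g n + B (f n))) \<longlonglongrightarrow> 0"
      using tendsto_mult[OF tendsto_const tendsto_norm[OF gB], of K] by simp
  qed
  have lim_swap: "(\<lambda>n. inner v (h n)) \<longlonglongrightarrow> l" if "(\<lambda>n. inner (h n) v) \<longlonglongrightarrow> l" for h :: "nat \<Rightarrow> 'a" and v l
    using that by (simp add: inner_commute)
  note lims = tendsto_add tendsto_diff tendsto_const tendsto_minus fgB fw Bw gw lim_swap[OF fw] lim_swap[OF Bw] lim_swap[OF gw]
  have qA: "- q \<in> A p"
  proof (rule maximally_monotone_op_memI[OF max])
    fix a v assume v: "v \<in> A a"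
    \<comment> \<open>The terms expand
      \<open>inner (f n - a) (g n - v) + inner (f n - p) (B (f n) - B p)\<close>, a sum of two
      nonnegative numbers. For \<open>Bq\<close> the same is done with the pair
      \<open>(p, - q)\<close> for \<open>A\<close> and the point \<open>b\<close> for
      \<open>B\<close>.\<close>
    have "(\<lambda>n. inner (f n) (g n + B (f n)) - inner p (B (f n)) - (inner (f n) (B p) - inner p (B p))
        - inner a (g n) - inner (f n) v + inner a v)
      \<longlonglongrightarrow> 0 - inner q p - (inner p (B p) - inner p (B p)) - - inner q a - inner p v + inner a v" (is "?s \<longlonglongrightarrow> ?l")
      by (intro lims)
    moreover have "0 \<le> ?s n" for n
      using monoA[OF gA v, of n] monoB'[of "f n" p]
      by (simp add: inner_diff inner_add inner_commute algebra_simps)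
    ultimately have "0 \<le> ?l" by (intro LIMSEQ_le_const) auto
    then show "0 \<le> inner (p - a) (- q - v)"
      by (simp add: inner_diff inner_commute algebra_simps)
  qed
  have Bq: "0 \<le> inner (p - b) (q - B b)" for b
  proof -
    have "(\<lambda>n. inner (f n) (g n + B (f n)) - inner p (g n) + inner (f n) q - inner p q
        - inner b (B (f n)) - inner (f n) (B b) + inner b (B b))
      \<longlonglongrightarrow> 0 - - inner q p + inner p q - inner p q - inner q b - inner p (B b) + inner b (B b)" (is "?s \<longlonglongrightarrow> ?l")
      by (intro lims)
    moreover have "0 \<le> ?s n" for n
      using monoA[OF gA qA, of n] monoB'[of "f n" b]
      by (simp add: inner_diff inner_add inner_commute algebra_simps)
    ultimately have "0 \<le> ?l" by (intro LIMSEQ_le_const) auto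
    then show ?thesis
      by (simp add: inner_diff inner_commute algebra_simps)
  qed
  define h where "h = B p - q"
  \<comment> \<open>With step \<open>1 / (2 * L)\<close> the Lipschitz bound gives
    \<open>norm (B p - B b) \<le> norm h / 2\<close>, so that
    \<open>0 \<le> inner h (B p - B b) - (norm h)^2\<close> already forces
    \<open>h = 0\<close>.\<close>
  define b where "b = p - (1 / (2 * L)) *\<^sub>R h"
  have "norm (B p - B b) \<le> L * norm (p - b)"
    using lipschitz_onD[OF L(2), of p b] by (simp add: dist_norm)
  also have "\<dots> = norm h / 2" using L(1) by (simp add: b_def)
  finally have Bb: "norm (B p - B b) \<le> norm h / 2" .
  have "0 \<le> inner h (q - B b)"
    using Bq[of b] L(1) by (simp add: b_def zero_le_mult_iff zero_le_divide_iff)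
  also have "q - B b = (B p - B b) - h" by (simp add: h_def)
  also have "inner h ((B p - B b) - h) = inner h (B p - B b) - (norm h)\<^sup>2"
    by (simp add: inner_diff_right power2_norm_eq_inner)
  also have "inner h (B p - B b) \<le> norm h * (norm h / 2)"
    using norm_cauchy_schwarz[of h] mult_left_mono[OF Bb norm_ge_zero[of h]] by (meson order_trans)
  finally have "(norm h)\<^sup>2 \<le> 0" by (simp add: power2_eq_square)
  then have "q = B p" by (simp add: h_def)
  with qA show ?thesis by simp
qed

text \<open>An exact expansion of \<open>(norm (w - z))^2\<close> around \<open>q\<close> and
  \<open>y\<close> leaves only \<open>(norm (q - y))^2\<close> to estimate, and
  \<open>norm (q - y) = c * norm (B y - r)\<close> is at most
  \<open>(1 - \<delta>) * norm (w - y)\<close> plus the error of \<open>r\<close> against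
  \<open>B w\<close>.\<close>

lemma forward_backward_forward_descent:
  fixes B :: "'a::real_inner \<Rightarrow> 'a" and w y r z :: 'a and c \<delta> L :: real
  assumes L: "L-lipschitz_on UNIV B"
    and c: "0 < c" "c * L \<le> 1 - \<delta>" and \<delta>: "0 < \<delta>" "\<delta> < 1"
  defines "q \<equiv> y - c *\<^sub>R (B y - r)"
  shows "(norm (q - z))\<^sup>2 + \<delta> * (norm (w - y))\<^sup>2 + 2 * inner (y - z) (w - q)
    \<le> (norm (w - z))\<^sup>2 + c\<^sup>2 / \<delta> * (norm (r - B w))\<^sup>2"
proof -
  define a where "a = norm (w - y)"
  define b where "b = c * norm (r - B w)"
  have a0: "0 \<le> a" and b0: "0 \<le> b" using c by (auto simp: a_def b_def)
  have "norm (B y - r) \<le> norm (B y - B w) + norm (r - B w)"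
    using norm_triangle_ineq[of "B y - B w" "B w - r"] by (simp add: norm_minus_commute)
  also have "norm (B y - B w) \<le> L * a"
    using lipschitz_onD[OF L, of y w] by (simp add: dist_norm a_def norm_minus_commute)
  finally have "c * norm (B y - r) \<le> c * (L * a + norm (r - B w))"
    using c by (intro mult_left_mono) auto
  also have "\<dots> = (c * L) * a + b" by (simp add: b_def algebra_simps)
  also have "\<dots> \<le> (1 - \<delta>) * a + b" using c a0 by (intro add_right_mono mult_right_mono)
  finally have "norm (q - y) \<le> (1 - \<delta>) * a + b"
    using c by (simp add: q_def)
  then have "(norm (q - y))\<^sup>2 \<le> ((1 - \<delta>) * a + b)\<^sup>2"
    by (intro power_mono) auto
  also have "\<dots> \<le> (1 - \<delta>) * a\<^sup>2 + b\<^sup>2 / \<delta>"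
  proof -
    \<comment> \<open>Convexity of the square for the combination
      \<open>(1 - \<delta>) * a + \<delta> * (b / \<delta>)\<close>, written with its explicit
      remainder.\<close>
    have "(1 - \<delta>) * a\<^sup>2 + b\<^sup>2 / \<delta> - ((1 - \<delta>) * a + b)\<^sup>2 = (1 - \<delta>) / \<delta> * (\<delta> * a - b)\<^sup>2"
      using \<delta> by (simp add: field_simps power2_eq_square)
    also have "\<dots> \<ge> 0" using \<delta> by simp
    finally show ?thesis by simp
  qed
  finally have "(norm (q - y))\<^sup>2 \<le> (1 - \<delta>) * (norm (w - y))\<^sup>2 + c\<^sup>2 / \<delta> * (norm (r - B w))\<^sup>2"
    by (simp add: a_def b_def power_mult_distrib)
  moreover have "(norm (w - z))\<^sup>2 = (norm (q - z))\<^sup>2 + 2 * inner (y - z) (w - q) + (norm (w - y))\<^sup>2 - (norm (q - y))\<^sup>2"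
    by (simp add: power2_norm_eq_inner inner_diff inner_commute algebra_simps)
  ultimately show ?thesis by (simp add: algebra_simps)
qed

section \<open>The stochastic iteration\<close>

lemma space_sigma_of [simp]: "space (sigma_of M X) = space M"
  unfolding sigma_of_def by (rule space_measure_of) auto

lemma sets_sigma_of:
  "sets (sigma_of M X) = sigma_sets (space M) (\<Union>f\<in>X. {f -` S \<inter> space M | S. S \<in> sets borel})"
  unfolding sigma_of_def by (rule sets_measure_of) auto

lemma measurable_sigma_of: "f \<in> X \<Longrightarrow> f \<in> borel_measurable (sigma_of M X)"
  by (rule measurableI) (auto simp: sets_sigma_of)

lemma subalgebra_sigma_of:
  assumes "\<And>f. f \<in> X \<Longrightarrow> f \<in> borel_measurable M"
  shows "subalgebra M (sigma_of M X)"
  unfolding subalgebra_def sets_sigma_of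
  using assms by (auto intro!: sets.sigma_sets_subset measurable_sets)

lemma subalgebra_sigma_of_mono: "X \<subseteq> Y \<Longrightarrow> subalgebra (sigma_of M Y) (sigma_of M X)"
  unfolding subalgebra_def sets_sigma_of by (auto intro!: sigma_sets_mono')

lemma norm_tendsto_0_if_summable_power2:
  assumes "summable (\<lambda>n. (norm (f n))\<^sup>2)"
  shows "(\<lambda>n. norm (f n)) \<longlonglongrightarrow> 0"
  using tendsto_real_sqrt[OF summable_LIMSEQ_zero[OF assms]] by simp

lemma nn_cond_exp_set_nn_integral:
  assumes "prob_space M" "subalgebra M N" and S: "S \<in> sets N"
    and f [measurable]: "f \<in> borel_measurable M"
  shows "(\<integral>\<^sup>+\<omega>\<in>S. nn_cond_exp M N f \<omega> \<partial>M) = (\<integral>\<^sup>+\<omega>\<in>S. f \<omega> \<partial>M)"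
proof -
  interpret prob_space M by fact
  interpret finite_measure_subalgebra M N
    by unfold_locales (use assms in auto)
  have "(\<integral>\<^sup>+\<omega>. indicator S \<omega> * nn_cond_exp M N f \<omega> \<partial>M) = (\<integral>\<^sup>+\<omega>. indicator S \<omega> * f \<omega> \<partial>M)"
    using S by (intro nn_cond_exp_intg) auto
  then show ?thesis by (simp add: mult.commute)
qed

locale stochastic_fbf = prob_space M for M :: "'w measure" +
  fixes A :: "'a::{real_inner, banach, second_countable_topology} \<Rightarrow> 'a set"
    and B :: "'a \<Rightarrow> 'a"
    and L \<theta> :: real
    and lam eps :: "nat \<Rightarrow> real"
    and x :: "int \<Rightarrow> 'w \<Rightarrow> 'a"
    and w y r s :: "nat \<Rightarrow> 'w \<Rightarrow> 'a"
  assumes maximally_monotone: "maximally_monotone_op A"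
    and monotone_B: "monotone_op (\<lambda>z. {B z})"
    and L_pos: "0 < L" and lipschitz_B: "L-lipschitz_on UNIV B"
    and \<theta>_nonneg: "0 \<le> \<theta>"
    and lam_pos: "\<And>n. 0 < lam n"
    and eps_nonneg: "\<And>n. 0 \<le> eps n" and eps_summable: "summable eps"
    and sfbf: "sfbf M A B \<theta> eps lam x w y r s"
begin

definition zer :: "'a set" where "zer = {z. - B z \<in> A z}"

definition p :: "nat \<Rightarrow> 'w \<Rightarrow> 'a" where
  "p n \<omega> = y n \<omega> - lam n *\<^sub>R (B (y n \<omega>) - r n \<omega>)"

text \<open>The element of \<open>A (y n \<omega>)\<close> singled out by the resolvent inclusion;
  \<open>u n \<omega> + B (y n \<omega>)\<close> is the residual of the inclusion problem at
  \<open>y n \<omega>\<close>.\<close>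

definition u :: "nat \<Rightarrow> 'w \<Rightarrow> 'a" where
  "u n \<omega> = (1 / lam n) *\<^sub>R (w n \<omega> - y n \<omega>) - r n \<omega>"

text \<open>Extended-valued, since the conditional second moment may be infinite before a
  summability hypothesis is imposed.\<close>

definition noise :: "nat \<Rightarrow> 'w \<Rightarrow> ennreal" where
  "noise n = nn_cond_exp M (history M x r n) (\<lambda>\<omega>. ennreal ((norm (s n \<omega> - B (y n \<omega>)))\<^sup>2))"

lemma monotone_A: "monotone_op A"
  using maximally_monotone unfolding maximally_monotone_op_def by blast

lemma
  assumes "\<omega> \<in> space M"
  shows w_eq: "w n \<omega> = x (int n) \<omega> + inertia \<theta> eps x n \<omega> *\<^sub>R (x (int n) \<omega> - x (int n - 1) \<omega>)"
    and x_Suc_eq: "x (int (Suc n)) \<omega> = p n \<omega> - lam n *\<^sub>R (s n \<omega> - B (y n \<omega>))"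
    and y_resolvent: "y n \<omega> \<in> resolvent (op_scale (lam n) A) (w n \<omega> - lam n *\<^sub>R r n \<omega>)"
proof -
  have *: "w n \<omega> = x (int n) \<omega> + inertia \<theta> eps x n \<omega> *\<^sub>R (x (int n) \<omega> - x (int n - 1) \<omega>) \<and>
      resolvent (op_scale (lam n) A) (w n \<omega> - lam n *\<^sub>R r n \<omega>) = {y n \<omega>} \<and>
      x (int n + 1) \<omega> = y n \<omega> - lam n *\<^sub>R (s n \<omega> - r n \<omega>)"
    using sfbf assms unfolding sfbf_def by blast
  then show "w n \<omega> = x (int n) \<omega> + inertia \<theta> eps x n \<omega> *\<^sub>R (x (int n) \<omega> - x (int n - 1) \<omega>)"
    and "y n \<omega> \<in> resolvent (op_scale (lam n) A) (w n \<omega> - lam n *\<^sub>R r n \<omega>)"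
    by blast+
  have "int (Suc n) = int n + 1" by simp
  then show "x (int (Suc n)) \<omega> = p n \<omega> - lam n *\<^sub>R (s n \<omega> - B (y n \<omega>))"
    using * by (simp only: p_def) (simp add: scaleR_diff_right)
qed

lemma u_mem: "\<omega> \<in> space M \<Longrightarrow> u n \<omega> \<in> A (y n \<omega>)"
  using y_resolvent[of \<omega> n] lam_pos[of n]
  by (simp add: resolvent_scale_iff u_def algebra_simps)

lemma w_minus_p: "w n \<omega> - p n \<omega> = lam n *\<^sub>R (u n \<omega> + B (y n \<omega>))"
  using lam_pos[of n] by (simp add: p_def u_def algebra_simps)

text \<open>The sigma-algebra \<open>N\<close> is left open because the result is applied both to
  \<open>M\<close> and to the history; the former is what makes the histories subalgebras of
  \<open>M\<close>.\<close>

lemma borel_measurable_w: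
  assumes [simp]: "space N = space M"
    and [measurable]: "x (int n) \<in> borel_measurable N" "x (int n - 1) \<in> borel_measurable N"
  shows "w n \<in> borel_measurable N"
proof -
  let ?d = "\<lambda>\<omega>. x (int n) \<omega> - x (int n - 1) \<omega>"
  have "(\<lambda>\<omega>. x (int n) \<omega> + (if norm (?d \<omega>) = 0 then \<theta> else min (eps n / norm (?d \<omega>)) \<theta>) *\<^sub>R ?d \<omega>)
      \<in> borel_measurable N"
    by measurable
  then show ?thesis
    by (rule measurable_cong[THEN iffD1, rotated]) (simp add: w_eq inertia_def)
qed

lemma borel_measurable_y:
  assumes "space N = space M" and [measurable]: "w n \<in> borel_measurable N" "r n \<in> borel_measurable N"
  shows "y n \<in> borel_measurable N"
proof (rule borel_measurable_resolvent[OF monotone_A lam_pos])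
  show "(\<lambda>\<omega>. w n \<omega> - lam n *\<^sub>R r n \<omega>) \<in> borel_measurable N"
    by measurable
qed (use assms(1) y_resolvent in auto)

lemma r_measurable [measurable]: "r n \<in> borel_measurable M"
  and s_measurable [measurable]: "s n \<in> borel_measurable M"
  using sfbf unfolding sfbf_def by auto

lemma B_measurable [measurable]: "B \<in> borel_measurable borel"
  using lipschitz_on_continuous_on[OF lipschitz_B] by (rule borel_measurable_continuous_onI)

text \<open>Two consecutive indices are carried through the induction because \<open>w n\<close>
  depends on both.\<close>

lemma x_measurable_aux: "x (int n) \<in> borel_measurable M \<and> x (int n - 1) \<in> borel_measurable M"
proof (induction n)
  case 0
  then show ?case using sfbf unfolding sfbf_def by auto
next
  case (Suc n)
  then have [measurable]: "x (int n) \<in> borel_measurable M" "w n \<in> borel_measurable M"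
    by (auto intro: borel_measurable_w)
  then have [measurable]: "y n \<in> borel_measurable M"
    by (auto intro: borel_measurable_y)
  have "(\<lambda>\<omega>. p n \<omega> - lam n *\<^sub>R (s n \<omega> - B (y n \<omega>))) \<in> borel_measurable M"
    unfolding p_def by measurable
  then have "x (int (Suc n)) \<in> borel_measurable M"
    by (rule measurable_cong[THEN iffD1, rotated]) (simp add: x_Suc_eq del: of_nat_Suc)
  then show ?case by simp
qed

lemma x_measurable [measurable]: "- 1 \<le> k \<Longrightarrow> x k \<in> borel_measurable M"
  using x_measurable_aux[of "nat (k + 1)"] by simp

lemma w_measurable [measurable]: "w n \<in> borel_measurable M"
  by (intro borel_measurable_w x_measurable) auto

lemma y_measurable [measurable]: "y n \<in> borel_measurable M"
  by (intro borel_measurable_y) auto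

sublocale filtered_prob_space M "history M x r"
proof
  show "subalgebra M (history M x r n)" for n
    unfolding history_def by (intro subalgebra_sigma_of) (auto intro: x_measurable)
  show "subalgebra (history M x r (Suc n)) (history M x r n)" for n
    unfolding history_def by (intro subalgebra_sigma_of_mono) auto
qed

lemma x_history [measurable]: "x (int n) \<in> borel_measurable (history M x r n)"
  and x_history': "x (int n - 1) \<in> borel_measurable (history M x r n)"
  and r_history [measurable]: "r n \<in> borel_measurable (history M x r n)"
  unfolding history_def by (intro measurable_sigma_of; auto)+

lemma w_history [measurable]: "w n \<in> borel_measurable (history M x r n)"
  by (intro borel_measurable_w x_history x_history') simp

lemma y_history [measurable]: "y n \<in> borel_measurable (history M x r n)"
  by (intro borel_measurable_y) auto

lemma p_history [measurable]: "p n \<in> borel_measurable (history M x r n)"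
  unfolding p_def by measurable

lemma noise_history [measurable]: "noise n \<in> borel_measurable (history M x r n)"
  unfolding noise_def by (rule borel_measurable_nn_cond_exp)

section \<open>Inertial error, descent and the quasi-Fejer property\<close>

lemma norm_w_minus_x:
  assumes "\<omega> \<in> space M"
  shows "norm (w n \<omega> - x (int n) \<omega>) \<le> eps n"
proof (cases "x (int n) \<omega> = x (int n - 1) \<omega>")
  case False
  let ?d = "norm (x (int n) \<omega> - x (int n - 1) \<omega>)"
  \<comment> \<open>The first entry of the minimum caps the inertial displacement at
    \<open>eps n\<close>, however far apart the last two iterates are.\<close>
  have "norm (w n \<omega> - x (int n) \<omega>) = min (eps n / ?d) \<theta> * ?d"
    using False eps_nonneg[of n] \<theta>_nonneg by (simp add: w_eq[OF assms] inertia_def)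
  also have "\<dots> \<le> eps n / ?d * ?d" by (intro mult_right_mono) auto
  also have "\<dots> = eps n" using False by simp
  finally show ?thesis .
qed (use eps_nonneg in \<open>simp add: w_eq[OF assms]\<close>)

text \<open>The cross term is linear in the distance; \<open>2 * a \<le> a^2 + 1\<close> trades it
  for the factor \<open>1 + eps n\<close> and a summable remainder.\<close>

lemma norm_w_minus_le:
  assumes "\<omega> \<in> space M"
  shows "(norm (w n \<omega> - z))\<^sup>2 \<le> (1 + eps n) * (norm (x (int n) \<omega> - z))\<^sup>2 + (eps n + (eps n)\<^sup>2)"
proof -
  let ?a = "norm (x (int n) \<omega> - z)"
  have "norm (w n \<omega> - z) \<le> ?a + eps n"
    using norm_triangle_ineq[of "x (int n) \<omega> - z" "w n \<omega> - x (int n) \<omega>"] norm_w_minus_x[OF assms, of n] by simp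
  then have "(norm (w n \<omega> - z))\<^sup>2 \<le> (?a + eps n)\<^sup>2" by (intro power_mono) auto
  also have "\<dots> = ?a\<^sup>2 + eps n * (2 * ?a) + (eps n)\<^sup>2" by (simp add: power2_eq_square algebra_simps)
  also have "\<dots> \<le> ?a\<^sup>2 + eps n * (?a\<^sup>2 + 1) + (eps n)\<^sup>2"
    using sum_squares_bound[of ?a 1] eps_nonneg[of n]
    by (intro add_mono mult_left_mono) auto
  finally show ?thesis by (simp add: algebra_simps)
qed

text \<open>Add the monotonicity of \<open>A\<close> between the pairs \<open>(y n, u n)\<close> and
  \<open>(z, - B z)\<close> to that of \<open>B\<close> between \<open>y n\<close> and
  \<open>z\<close>.\<close>

lemma zer_gap_nonneg:
  assumes "\<omega> \<in> space M" "z \<in> zer"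
  shows "0 \<le> inner (y n \<omega> - z) (u n \<omega> + B (y n \<omega>))"
proof -
  have "0 \<le> inner (y n \<omega> - z) (u n \<omega> - - B z)"
    using monotone_A u_mem[OF assms(1)] assms(2) unfolding monotone_op_def zer_def by blast
  moreover have "0 \<le> inner (y n \<omega> - z) (B (y n \<omega>) - B z)"
    using monotone_B unfolding monotone_op_def by simp
  ultimately show ?thesis by (simp add: inner_add_right inner_diff_right)
qed

lemma noise_martingale_difference:
  shows "integrable M (\<lambda>\<omega>. s n \<omega> - B (y n \<omega>))"
    and "S \<in> sets (history M x r n) \<Longrightarrow> (LINT \<omega>:S|M. s n \<omega> - B (y n \<omega>)) = 0"
proof -
  have c: "is_cond_exp M (history M x r n) (s n) (\<lambda>\<omega>. B (y n \<omega>))"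
    using sfbf unfolding sfbf_def by blast
  then have int: "integrable M (s n)" "integrable M (\<lambda>\<omega>. B (y n \<omega>))"
    unfolding is_cond_exp_def by auto
  then show "integrable M (\<lambda>\<omega>. s n \<omega> - B (y n \<omega>))" by simp
  assume S: "S \<in> sets (history M x r n)"
  then have "set_integrable M S (s n)" "set_integrable M S (\<lambda>\<omega>. B (y n \<omega>))"
    using int sets_F_subset unfolding set_integrable_def by (auto intro: integrable_mult_indicator)
  then show "(LINT \<omega>:S|M. s n \<omega> - B (y n \<omega>)) = 0"
    using c S unfolding is_cond_exp_def by (simp add: set_integral_diff)
qed

text \<open>Over sets of the history the cross term between \<open>p n - z\<close> and the
  martingale difference drops out, and there \<open>noise n\<close> has the same integrals as the
  squared error it replaces.\<close>

lemma step_nn_integral: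
  assumes S: "S \<in> sets (history M x r n)"
  shows "(\<integral>\<^sup>+\<omega>\<in>S. ennreal ((norm (x (int (Suc n)) \<omega> - z))\<^sup>2) \<partial>M)
    \<le> (\<integral>\<^sup>+\<omega>\<in>S. (ennreal ((norm (p n \<omega> - z))\<^sup>2) + ennreal ((lam n)\<^sup>2) * noise n \<omega>) \<partial>M)"
proof -
  let ?d = "\<lambda>\<omega>. lam n *\<^sub>R (s n \<omega> - B (y n \<omega>))"
  note [measurable] = sets_F_subset[OF S] measurable_F_M[OF p_history] measurable_F_M[OF noise_history]
  have S_space: "\<omega> \<in> space M" if "\<omega> \<in> S" for \<omega>
    using sets.sets_into_space[OF S] that by auto
  have "(\<integral>\<^sup>+\<omega>\<in>S. ennreal ((norm (x (int (Suc n)) \<omega> - z))\<^sup>2) \<partial>M)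
      = (\<integral>\<^sup>+\<omega>\<in>S. ennreal ((norm ((p n \<omega> - z) - ?d \<omega>))\<^sup>2) \<partial>M)"
    by (intro nn_integral_cong) (auto simp: x_Suc_eq S_space algebra_simps simp del: of_nat_Suc split: split_indicator)
  also have "\<dots> \<le> (\<integral>\<^sup>+\<omega>\<in>S. ennreal ((norm (p n \<omega> - z))\<^sup>2) \<partial>M) + (\<integral>\<^sup>+\<omega>\<in>S. ennreal ((norm (?d \<omega>))\<^sup>2) \<partial>M)"
  proof (rule nn_integral_norm_diff_martingale_difference[OF subalgebra_F _ _ _ S])
    show "integrable M ?d" by (intro integrable_scaleR_right noise_martingale_difference)
    show "(LINT \<omega>:T|M. ?d \<omega>) = 0" if "T \<in> sets (history M x r n)" for T
      using noise_martingale_difference(2)[OF that] by simp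
  qed measurable
  also have "(\<integral>\<^sup>+\<omega>\<in>S. ennreal ((norm (?d \<omega>))\<^sup>2) \<partial>M)
      = (\<integral>\<^sup>+\<omega>. ennreal ((lam n)\<^sup>2) * (ennreal ((norm (s n \<omega> - B (y n \<omega>)))\<^sup>2) * indicator S \<omega>) \<partial>M)"
    by (intro nn_integral_cong) (auto simp: power_mult_distrib ennreal_mult split: split_indicator)
  also have "\<dots> = ennreal ((lam n)\<^sup>2) * (\<integral>\<^sup>+\<omega>\<in>S. ennreal ((norm (s n \<omega> - B (y n \<omega>)))\<^sup>2) \<partial>M)"
    by (intro nn_integral_cmult) measurable
  also have "(\<integral>\<^sup>+\<omega>\<in>S. ennreal ((norm (s n \<omega> - B (y n \<omega>)))\<^sup>2) \<partial>M) = (\<integral>\<^sup>+\<omega>\<in>S. noise n \<omega> \<partial>M)"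
    unfolding noise_def
    by (intro nn_cond_exp_set_nn_integral[symmetric] subalgebra_F S prob_space_axioms) measurable
  also have "ennreal ((lam n)\<^sup>2) * (\<integral>\<^sup>+\<omega>\<in>S. noise n \<omega> \<partial>M) = (\<integral>\<^sup>+\<omega>\<in>S. (ennreal ((lam n)\<^sup>2) * noise n \<omega>) \<partial>M)"
    by (subst nn_integral_cmult[symmetric]) (auto simp: mult.assoc)
  also have "(\<integral>\<^sup>+\<omega>\<in>S. ennreal ((norm (p n \<omega> - z))\<^sup>2) \<partial>M) + (\<integral>\<^sup>+\<omega>\<in>S. (ennreal ((lam n)\<^sup>2) * noise n \<omega>) \<partial>M)
      = (\<integral>\<^sup>+\<omega>\<in>S. (ennreal ((norm (p n \<omega> - z))\<^sup>2) + ennreal ((lam n)\<^sup>2) * noise n \<omega>) \<partial>M)"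
    by (subst nn_integral_add[symmetric]) (auto simp: distrib_right)
  finally show ?thesis .
qed

text \<open>The one-step integral bound, the descent inequality and the inertial estimate combine to
  the Robbins-Siegmund form with \<open>a = eps\<close>: \<open>b\<close> gathers the inertial,
  \<open>r\<close> and noise errors, and both summability claims are read off the gain
  \<open>c\<close>.\<close>

lemma quasi_fejer:
  assumes z: "z \<in> zer" and \<delta>: "0 < \<delta>" "\<delta> < 1"
    and step_size: "\<And>n. N \<le> n \<Longrightarrow> lam n * L \<le> 1 - \<delta>"
    and r_sum: "AE \<omega> in M. summable (\<lambda>n. (lam n)\<^sup>2 * (norm (r n \<omega> - B (w n \<omega>)))\<^sup>2)"
    and noise_sum: "AE \<omega> in M. (\<Sum>n. ennreal ((lam n)\<^sup>2) * noise n \<omega>) < \<infinity>"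
  shows "AE \<omega> in M. convergent (\<lambda>n. norm (x (int n) \<omega> - z)) \<and>
    summable (\<lambda>n. (norm (w n \<omega> - y n \<omega>))\<^sup>2) \<and>
    summable (\<lambda>n. lam n * inner (y n \<omega> - z) (u n \<omega> + B (y n \<omega>)))"
proof -
  \<comment> \<open>A real version of the weighted noise: almost surely the series is finite, hence
    every term is, and \<open>enn2real\<close> then loses nothing.\<close>
  define q where "q n \<omega> = (lam n)\<^sup>2 * enn2real (noise n \<omega>)" for n \<omega>
  define V where "V n \<omega> = (norm (x (int n) \<omega> - z))\<^sup>2" for n \<omega>
  define b where "b n \<omega> = eps n + (eps n)\<^sup>2 + (lam n)\<^sup>2 / \<delta> * (norm (r n \<omega> - B (w n \<omega>)))\<^sup>2 + q n \<omega>" for n \<omega>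
  \<comment> \<open>The absolute value changes nothing on \<open>space M\<close>, where the gap is
    nonnegative; it makes \<open>c\<close> nonnegative at every point, as
    \<open>robbins_siegmund\<close> demands.\<close>
  define c where "c n \<omega> = \<delta> * (norm (w n \<omega> - y n \<omega>))\<^sup>2 + 2 * \<bar>inner (y n \<omega> - z) (w n \<omega> - p n \<omega>)\<bar>" for n \<omega>
  have c_eq: "c n \<omega> = \<delta> * (norm (w n \<omega> - y n \<omega>))\<^sup>2 + 2 * inner (y n \<omega> - z) (w n \<omega> - p n \<omega>)"
    if "\<omega> \<in> space M" for n \<omega>
    using zer_gap_nonneg[OF that z, of n] lam_pos[of n] by (simp add: c_def w_minus_p)
  have q0: "0 \<le> q n \<omega>" for n \<omega> by (simp add: q_def)
  have V0: "0 \<le> V n \<omega>" and b0: "0 \<le> b n \<omega>" and c0: "0 \<le> c n \<omega>" for n \<omega>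
    using \<delta> q0 eps_nonneg by (auto simp: V_def b_def c_def intro!: add_nonneg_nonneg)
  have [measurable]: "q n \<in> borel_measurable (history M x r n)" for n
    unfolding q_def by measurable
  have Vm: "V n \<in> borel_measurable (history M x r n)" for n
    unfolding V_def by measurable
  have bm: "b n \<in> borel_measurable (history M x r n)" for n
    unfolding b_def by measurable
  have cm: "c n \<in> borel_measurable (history M x r n)" for n
    unfolding c_def by measurable
  have noise_q: "AE \<omega> in M. (\<forall>n. ennreal ((lam n)\<^sup>2) * noise n \<omega> = ennreal (q n \<omega>)) \<and> summable (\<lambda>n. q n \<omega>)"
    using noise_sum
  proof eventually_elim
    case (elim \<omega>)
    have eq: "ennreal ((lam n)\<^sup>2) * noise n \<omega> = ennreal (q n \<omega>)" for n
    proof -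
      have "ennreal ((lam n)\<^sup>2) * noise n \<omega> < \<top>"
        using ennreal_suminf_lessD[of "\<lambda>n. ennreal ((lam n)\<^sup>2) * noise n \<omega>" \<infinity> n] elim by simp
      then have "noise n \<omega> < \<top>"
        using lam_pos[of n] by (auto simp: ennreal_mult_less_top)
      then show ?thesis by (simp add: q_def ennreal_mult)
    qed
    then have "(\<Sum>n. ennreal (q n \<omega>)) \<noteq> \<top>" using elim by simp
    then have "summable (\<lambda>n. q n \<omega>)"
      using q0 by (intro summable_suminf_not_top)
    with eq show ?case by blast
  qed
  have eps2: "summable (\<lambda>n. (eps n)\<^sup>2)"
  proof (rule summable_comparison_test_ev[OF _ eps_summable])
    have "\<forall>\<^sub>F n in sequentially. eps n < 1"
      using summable_LIMSEQ_zero[OF eps_summable] by (rule order_tendstoD) simp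
    then show "\<forall>\<^sub>F n in sequentially. norm ((eps n)\<^sup>2) \<le> eps n"
      by eventually_elim (use eps_nonneg in \<open>auto simp: power2_eq_square mult_left_le\<close>)
  qed
  have step: "(\<integral>\<^sup>+\<omega>\<in>S. ennreal (V (Suc n) \<omega> + c n \<omega>) \<partial>M)
      \<le> (\<integral>\<^sup>+\<omega>\<in>S. ennreal ((1 + eps n) * V n \<omega> + b n \<omega>) \<partial>M)"
    if S: "S \<in> sets (history M x r n)" and n: "N \<le> n" for n S
  proof -
    note [measurable] = sets_F_subset[OF S] measurable_F_M[OF Vm] measurable_F_M[OF bm] measurable_F_M[OF cm]
      measurable_F_M[OF p_history] measurable_F_M[OF noise_history]
    have S_space: "\<omega> \<in> space M" if "\<omega> \<in> S" for \<omega>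
      using sets.sets_into_space[OF S] that by auto
    have "(\<integral>\<^sup>+\<omega>\<in>S. ennreal (V (Suc n) \<omega> + c n \<omega>) \<partial>M)
        = (\<integral>\<^sup>+\<omega>\<in>S. ennreal (V (Suc n) \<omega>) \<partial>M) + (\<integral>\<^sup>+\<omega>\<in>S. ennreal (c n \<omega>) \<partial>M)"
      using c0 by (subst nn_integral_add[symmetric])
        (auto intro!: nn_integral_cong simp: V_def ennreal_plus split: split_indicator)
    also have "\<dots> \<le> (\<integral>\<^sup>+\<omega>\<in>S. (ennreal ((norm (p n \<omega> - z))\<^sup>2) + ennreal ((lam n)\<^sup>2) * noise n \<omega>) \<partial>M)
        + (\<integral>\<^sup>+\<omega>\<in>S. ennreal (c n \<omega>) \<partial>M)"
      unfolding V_def by (intro add_right_mono step_nn_integral S)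
    also have "\<dots> = (\<integral>\<^sup>+\<omega>. ((ennreal ((norm (p n \<omega> - z))\<^sup>2) + ennreal ((lam n)\<^sup>2) * noise n \<omega>) * indicator S \<omega>
        + ennreal (c n \<omega>) * indicator S \<omega>) \<partial>M)"
      by (intro nn_integral_add[symmetric]) measurable
    also have "\<dots> \<le> (\<integral>\<^sup>+\<omega>\<in>S. ennreal ((1 + eps n) * V n \<omega> + b n \<omega>) \<partial>M)"
    proof (rule nn_integral_mono_AE)
      show "AE \<omega> in M. (ennreal ((norm (p n \<omega> - z))\<^sup>2) + ennreal ((lam n)\<^sup>2) * noise n \<omega>) * indicator S \<omega>
          + ennreal (c n \<omega>) * indicator S \<omega> \<le> ennreal ((1 + eps n) * V n \<omega> + b n \<omega>) * indicator S \<omega>"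
        using noise_q
      proof eventually_elim
        case (elim \<omega>)
        show ?case
        proof (cases "\<omega> \<in> S")
          case True
          then have \<omega>: "\<omega> \<in> space M" by (rule S_space)
          have "(norm (p n \<omega> - z))\<^sup>2 + c n \<omega> \<le> (norm (w n \<omega> - z))\<^sup>2 + (lam n)\<^sup>2 / \<delta> * (norm (r n \<omega> - B (w n \<omega>)))\<^sup>2"
            using forward_backward_forward_descent[OF lipschitz_B lam_pos step_size[OF n] \<delta>, of "y n \<omega>" "r n \<omega>" z "w n \<omega>"]
            by (simp add: c_eq[OF \<omega>] p_def)
          also have "\<dots> \<le> (1 + eps n) * V n \<omega> + (b n \<omega> - q n \<omega>)"
            using norm_w_minus_le[OF \<omega>, of n z] by (simp add: V_def b_def)
          finally have "ennreal ((norm (p n \<omega> - z))\<^sup>2 + q n \<omega> + c n \<omega>) \<le> ennreal ((1 + eps n) * V n \<omega> + b n \<omega>)"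
            by (intro ennreal_leI) simp
          then show ?thesis
            using True elim c0 q0 by (simp add: ennreal_plus)
        qed simp
      qed
    qed
    finally show ?thesis .
  qed
  have "AE \<omega> in M. convergent (\<lambda>n. V (n + N) \<omega>) \<and> summable (\<lambda>n. c (n + N) \<omega>)"
  proof -
    \<comment> \<open>The step-size bound is available only from \<open>N\<close> on, so the theorem
      is applied to the filtration started there; convergence and summability ignore the first
      \<open>N\<close> terms.\<close>
    interpret shifted: filtered_prob_space M "\<lambda>n. history M x r (n + N)"
      by unfold_locales (use subalgebra_F subalgebra_Suc in auto)
    show ?thesis
    proof (rule shifted.robbins_siegmund[where a="\<lambda>n. eps (n + N)" and b="\<lambda>n. b (n + N)"])
      show "summable (\<lambda>n. eps (n + N))"
        using eps_summable by (simp add: summable_iff_shift)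
      show "AE \<omega> in M. summable (\<lambda>n. b (n + N) \<omega>)"
        using noise_q r_sum
      proof eventually_elim
        case (elim \<omega>)
        have "summable (\<lambda>n. 1 / \<delta> * ((lam n)\<^sup>2 * (norm (r n \<omega> - B (w n \<omega>)))\<^sup>2))"
          using elim by (intro summable_mult)
        then have "summable (\<lambda>n. b n \<omega>)"
          unfolding b_def using elim eps2 eps_summable by (intro summable_add) auto
        then show ?case by (rule summable_ignore_initial_segment)
      qed
      show "(\<integral>\<^sup>+\<omega>\<in>S. ennreal (V (Suc n + N) \<omega> + c (n + N) \<omega>) \<partial>M)
          \<le> (\<integral>\<^sup>+\<omega>\<in>S. ennreal ((1 + eps (n + N)) * V (n + N) \<omega> + b (n + N) \<omega>) \<partial>M)"
        if "S \<in> sets (history M x r (n + N))" for n S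
        using step[OF that] by simp
    qed (rule Vm bm cm V0 b0 c0 eps_nonneg)+
  qed
  with AE_space show ?thesis
  proof eventually_elim
    case (elim \<omega>)
    have "convergent (\<lambda>n. V n \<omega>)"
      using elim convergent_ignore_initial_segment[of "\<lambda>n. V n \<omega>" N] by simp
    then obtain l where "(\<lambda>n. V n \<omega>) \<longlonglongrightarrow> l" unfolding convergent_def by blast
    then have "(\<lambda>n. sqrt (V n \<omega>)) \<longlonglongrightarrow> sqrt l" by (rule tendsto_real_sqrt)
    then have conv: "convergent (\<lambda>n. norm (x (int n) \<omega> - z))"
      by (auto simp: V_def convergent_def)
    have c_sum: "summable (\<lambda>n. c n \<omega>)"
      using elim summable_iff_shift[of "\<lambda>n. c n \<omega>" N] by simp
    have "summable (\<lambda>n. 1 / \<delta> * c n \<omega>)" using c_sum by (rule summable_mult)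
    then have "summable (\<lambda>n. (norm (w n \<omega> - y n \<omega>))\<^sup>2)"
      by (rule summable_comparison_test[rotated]) (use \<delta> in \<open>auto simp: c_def field_simps intro!: exI[of _ 0]\<close>)
    moreover have "summable (\<lambda>n. lam n * inner (y n \<omega> - z) (u n \<omega> + B (y n \<omega>)))"
    proof (rule summable_comparison_test[OF _ c_sum], intro exI allI impI)
      fix n
      show "norm (lam n * inner (y n \<omega> - z) (u n \<omega> + B (y n \<omega>))) \<le> c n \<omega>"
        using \<delta> by (simp add: c_def w_minus_p)
    qed
    ultimately show ?case using conv by blast
  qed
qed


section \<open>Almost sure weak and strong convergence\<close>

lemma weakly_convergent:
  assumes ne: "zer \<noteq> {}"
    and \<epsilon>: "0 < \<epsilon>" and lam: "\<And>n. lam n \<in> {\<epsilon><..<(1 - \<epsilon>) / L}"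
    and noise_sum: "AE \<omega> in M. (\<Sum>n. noise n \<omega>) < \<infinity>"
    and r_sum: "AE \<omega> in M. summable (\<lambda>n. (norm (r n \<omega> - B (w n \<omega>)))\<^sup>2)"
  shows "\<exists>xbar \<in> borel_measurable M. (\<forall>\<omega>\<in>space M. xbar \<omega> \<in> zer) \<and>
    (AE \<omega> in M. weakly_converges (\<lambda>n. x (int n) \<omega>) (xbar \<omega>))"
proof -
  have lamL: "lam n * L \<le> 1 - \<epsilon>" and lam_ge: "\<epsilon> \<le> lam n" for n
    using lam[of n] L_pos by (auto simp: pos_less_divide_eq)
  have \<epsilon>1: "\<epsilon> < 1"
    using lamL[of 0] mult_pos_pos[OF lam_pos[of 0] L_pos] by linarith
  \<comment> \<open>The bound \<open>lam n * L \<le> 1\<close> turns the unweighted error sums of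
    the hypotheses into the weighted ones that \<open>quasi_fejer\<close> takes.\<close>
  have lam2: "(lam n)\<^sup>2 \<le> 1 / L\<^sup>2" for n
  proof -
    have "(lam n * L)\<^sup>2 \<le> 1\<^sup>2"
      using lamL[of n] lam_pos[of n] L_pos \<epsilon> by (intro power_mono) auto
    then show ?thesis using L_pos by (simp add: power_mult_distrib pos_le_divide_eq)
  qed
  have r_sum': "AE \<omega> in M. summable (\<lambda>n. (lam n)\<^sup>2 * (norm (r n \<omega> - B (w n \<omega>)))\<^sup>2)"
    using r_sum
  proof eventually_elim
    case (elim \<omega>)
    have "summable (\<lambda>n. 1 / L\<^sup>2 * (norm (r n \<omega> - B (w n \<omega>)))\<^sup>2)"
      using elim by (rule summable_mult)
    then show ?case
    proof (rule summable_comparison_test[rotated], intro exI allI impI)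
      fix n
      show "norm ((lam n)\<^sup>2 * (norm (r n \<omega> - B (w n \<omega>)))\<^sup>2) \<le> 1 / L\<^sup>2 * (norm (r n \<omega> - B (w n \<omega>)))\<^sup>2"
        using mult_right_mono[OF lam2[of n], of "(norm (r n \<omega> - B (w n \<omega>)))\<^sup>2"] by simp
    qed
  qed
  have noise_sum': "AE \<omega> in M. (\<Sum>n. ennreal ((lam n)\<^sup>2) * noise n \<omega>) < \<infinity>"
    using noise_sum
  proof eventually_elim
    case (elim \<omega>)
    have "(\<Sum>n. ennreal ((lam n)\<^sup>2) * noise n \<omega>) \<le> (\<Sum>n. ennreal (1 / L\<^sup>2) * noise n \<omega>)"
      using lam2 by (intro suminf_le mult_right_mono ennreal_leI) auto
    also have "\<dots> = ennreal (1 / L\<^sup>2) * (\<Sum>n. noise n \<omega>)" by simp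
    also have "\<dots> < \<infinity>" using elim by (simp add: ennreal_mult_less_top)
    finally show ?case .
  qed
  obtain D where D: "countable D" "D \<subseteq> zer" "zer \<subseteq> closure D"
    using separable[of zer] by metis
  obtain z0 where z0: "z0 \<in> zer" using ne by blast
  have "AE \<omega> in M. \<forall>z\<in>D. convergent (\<lambda>n. norm (x (int n) \<omega> - z)) \<and>
    summable (\<lambda>n. (norm (w n \<omega> - y n \<omega>))\<^sup>2) \<and>
    summable (\<lambda>n. lam n * inner (y n \<omega> - z) (u n \<omega> + B (y n \<omega>)))"
    using D(2) quasi_fejer[OF _ \<epsilon> \<epsilon>1 lamL r_sum' noise_sum']
    by (intro AE_ball_countable[OF D(1), THEN iffD2] ballI) blast
  with AE_space r_sum
  have main: "AE \<omega> in M. \<exists>q\<in>zer. weakly_converges (\<lambda>n. x (int n) \<omega>) q"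
  proof eventually_elim
    case (elim \<omega>)
    have \<omega>: "\<omega> \<in> space M" by fact
    have "D \<noteq> {}" using D z0 by auto
    \<comment> \<open>The distances to \<open>z\<close> and to \<open>d\<close> differ by at most
      \<open>dist d z\<close>, uniformly in \<open>n\<close>, so the Cauchy property passes from
      \<open>D\<close> to its closure.\<close>
    have conv: "convergent (\<lambda>n. norm (x (int n) \<omega> - z))" if "z \<in> zer" for z
    proof (rule Cauchy_convergent, rule CauchyI)
      fix e :: real assume "0 < e"
      then have "0 < e / 3" by simp
      moreover have "z \<in> closure D" using D(3) that by blast
      ultimately obtain d where d: "d \<in> D" "dist d z < e / 3"
        unfolding closure_approachable by blast
      have near: "\<bar>norm (x (int n) \<omega> - z) - norm (x (int n) \<omega> - d)\<bar> < e / 3" for n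
      proof -
        have "\<bar>norm (x (int n) \<omega> - z) - norm (x (int n) \<omega> - d)\<bar> \<le> norm ((x (int n) \<omega> - z) - (x (int n) \<omega> - d))"
          by (rule norm_triangle_ineq3)
        also have "\<dots> < e / 3" using d(2) by (simp only: dist_norm) simp
        finally show ?thesis .
      qed
      have d_conv: "convergent (\<lambda>n. norm (x (int n) \<omega> - d))" using elim d by blast
      obtain N where N: "\<And>m n. m \<ge> N \<Longrightarrow> n \<ge> N \<Longrightarrow>
          norm (norm (x (int m) \<omega> - d) - norm (x (int n) \<omega> - d)) < e / 3"
        using CauchyD[OF convergent_Cauchy[OF d_conv], of "e / 3"] \<open>0 < e\<close> by auto
      have "norm (norm (x (int m) \<omega> - z) - norm (x (int n) \<omega> - z)) < e" if "m \<ge> N" "n \<ge> N" for m n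
        using N[OF that] near[of m] near[of n] unfolding real_norm_def by linarith
      then show "\<exists>N. \<forall>m\<ge>N. \<forall>n\<ge>N. norm (norm (x (int m) \<omega> - z) - norm (x (int n) \<omega> - z)) < e"
        by blast
    qed
    have wy: "(\<lambda>n. norm (w n \<omega> - y n \<omega>)) \<longlonglongrightarrow> 0"
      using elim \<open>D \<noteq> {}\<close> by (intro norm_tendsto_0_if_summable_power2) blast
    have e: "(\<lambda>n. norm (r n \<omega> - B (w n \<omega>))) \<longlonglongrightarrow> 0"
      using elim by (intro norm_tendsto_0_if_summable_power2) blast
    have yx: "(\<lambda>n. y n \<omega> - x (int n) \<omega>) \<longlonglongrightarrow> 0"
    proof (rule Lim_null_comparison[OF always_eventually])
      show "\<forall>n. norm (y n \<omega> - x (int n) \<omega>) \<le> norm (w n \<omega> - y n \<omega>) + eps n"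
      proof
        fix n
        have "norm (y n \<omega> - x (int n) \<omega>) \<le> norm (y n \<omega> - w n \<omega>) + norm (w n \<omega> - x (int n) \<omega>)"
          using norm_triangle_ineq[of "y n \<omega> - w n \<omega>" "w n \<omega> - x (int n) \<omega>"] by simp
        then show "norm (y n \<omega> - x (int n) \<omega>) \<le> norm (w n \<omega> - y n \<omega>) + eps n"
          using norm_w_minus_x[OF \<omega>, of n] by (simp add: norm_minus_commute)
      qed
      show "(\<lambda>n. norm (w n \<omega> - y n \<omega>) + eps n) \<longlonglongrightarrow> 0"
        using tendsto_add[OF wy summable_LIMSEQ_zero[OF eps_summable]] by simp
    qed
    have null: "(\<lambda>n. u n \<omega> + B (y n \<omega>)) \<longlonglongrightarrow> 0"
    proof (rule Lim_null_comparison[OF always_eventually])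
      let ?b = "\<lambda>n. (1 / \<epsilon> + L) * norm (w n \<omega> - y n \<omega>) + norm (r n \<omega> - B (w n \<omega>))"
      show "\<forall>n. norm (u n \<omega> + B (y n \<omega>)) \<le> ?b n"
      proof
        fix n
        \<comment> \<open>The first part is small since \<open>lam n\<close> stays above
          \<open>\<epsilon>\<close> and \<open>w n - y n\<close> tends to 0, the second by the
          Lipschitz bound, the third by the hypothesis on \<open>r n\<close>.\<close>
        have "u n \<omega> + B (y n \<omega>) = (1 / lam n) *\<^sub>R (w n \<omega> - y n \<omega>) + (B (y n \<omega>) - B (w n \<omega>)) + (B (w n \<omega>) - r n \<omega>)"
          by (simp add: u_def)
        also have "norm \<dots> \<le> norm ((1 / lam n) *\<^sub>R (w n \<omega> - y n \<omega>)) + norm (B (y n \<omega>) - B (w n \<omega>)) + norm (B (w n \<omega>) - r n \<omega>)"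
          by (meson add_right_mono norm_triangle_ineq order_trans)
        also have "norm ((1 / lam n) *\<^sub>R (w n \<omega> - y n \<omega>)) = 1 / lam n * norm (w n \<omega> - y n \<omega>)"
          using lam_pos[of n] by simp
        also have "1 / lam n * norm (w n \<omega> - y n \<omega>) \<le> 1 / \<epsilon> * norm (w n \<omega> - y n \<omega>)"
          using lam_ge[of n] \<epsilon> by (intro mult_right_mono divide_left_mono) auto
        also have "norm (B (y n \<omega>) - B (w n \<omega>)) \<le> L * norm (w n \<omega> - y n \<omega>)"
          using lipschitz_onD[OF lipschitz_B, of "y n \<omega>" "w n \<omega>"] by (simp add: dist_norm norm_minus_commute)
        finally show "norm (u n \<omega> + B (y n \<omega>)) \<le> ?b n"
          by (simp add: norm_minus_commute distrib_right)
      qed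
      show "?b \<longlonglongrightarrow> 0"
        using tendsto_add[OF tendsto_mult[OF tendsto_const wy] e] by simp
    qed
    obtain K where K: "\<And>n. norm (x (int n) \<omega> - z0) \<le> K"
      using convergent_imp_Bseq[OF conv[OF z0]] unfolding Bseq_def by fastforce
    obtain K' where K': "\<And>n. norm (y n \<omega> - x (int n) \<omega>) \<le> K'"
      using convergent_imp_Bseq[OF convergentI[OF yx]] unfolding Bseq_def by blast
    have y_bdd: "norm (y n \<omega>) \<le> K' + K + norm z0" for n
      using norm_triangle_ineq[of "y n \<omega> - x (int n) \<omega>" "x (int n) \<omega> - z0"]
        norm_triangle_sub[of "y n \<omega>" z0] K[of n] K'[of n] by simp
    show ?case
    proof (rule opial[OF ne conv])
      fix t a assume t: "strict_mono t" and a: "weakly_converges ((\<lambda>n. x (int n) \<omega>) \<circ> t) a"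
      show "a \<in> zer"
        unfolding zer_def mem_Collect_eq
      proof (rule zeros_demiclosed[OF maximally_monotone monotone_B L_pos lipschitz_B])
        show "bounded (range (\<lambda>n. y (t n) \<omega>))" unfolding bounded_iff using y_bdd by auto
        show "weakly_converges (\<lambda>n. y (t n) \<omega>) a"
          using LIMSEQ_subseq_LIMSEQ[OF yx t]
          by (intro weakly_converges_add_null[OF a]) (simp add: o_def)
        show "u (t n) \<omega> \<in> A (y (t n) \<omega>)" for n by (rule u_mem[OF \<omega>])
        show "(\<lambda>n. u (t n) \<omega> + B (y (t n) \<omega>)) \<longlonglongrightarrow> 0"
          using LIMSEQ_subseq_LIMSEQ[OF null t] by (simp add: o_def)
      qed
    qed blast+
  qed
  then obtain N where N: "N \<in> null_sets M"
    and good: "\<And>\<omega>. \<omega> \<in> space M - N \<Longrightarrow> \<exists>q\<in>zer. weakly_converges (\<lambda>n. x (int n) \<omega>) q"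
    unfolding eventually_ae_filter by blast
  \<comment> \<open>On the null set the value is the fixed zero \<open>z0\<close>, so
    \<open>xbar\<close> lies in \<open>zer\<close> everywhere. Each
    \<open>inner (xbar \<omega>) v\<close> is then a pointwise limit of measurable functions, which
    makes the choice by \<open>SOME\<close> measurable.\<close>
  define xbar where "xbar \<omega> = (if \<omega> \<in> N then z0
    else SOME q. q \<in> zer \<and> weakly_converges (\<lambda>n. x (int n) \<omega>) q)" for \<omega>
  have xbar: "xbar \<omega> \<in> zer" "weakly_converges (\<lambda>n. x (int n) \<omega>) (xbar \<omega>)" if "\<omega> \<in> space M - N" for \<omega>
    using someI_ex[of "\<lambda>q. q \<in> zer \<and> weakly_converges (\<lambda>n. x (int n) \<omega>) q"] good[OF that] that
    by (auto simp: xbar_def)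
  have [measurable]: "N \<in> sets M" using N by blast
  have "xbar \<in> borel_measurable M"
  proof (rule borel_measurable_weakly)
    fix v
    have "(\<lambda>n. inner (if \<omega> \<in> N then z0 else x (int n) \<omega>) v) \<longlonglongrightarrow> inner (xbar \<omega>) v" if "\<omega> \<in> space M" for \<omega>
      using xbar(2)[of \<omega>] that by (auto simp: xbar_def weakly_converges_def)
    then show "(\<lambda>\<omega>. inner (xbar \<omega>) v) \<in> borel_measurable M"
      by (rule borel_measurable_LIMSEQ_real[where u="\<lambda>n \<omega>. inner (if \<omega> \<in> N then z0 else x (int n) \<omega>) v"]) measurable
  qed
  moreover have "\<forall>\<omega>\<in>space M. xbar \<omega> \<in> zer"
    using xbar(1) z0 by (auto simp: xbar_def)
  moreover have "AE \<omega> in M. weakly_converges (\<lambda>n. x (int n) \<omega>) (xbar \<omega>)"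
    using AE_not_in[OF N] AE_space by eventually_elim (use xbar(2) in auto)
  ultimately show ?thesis by blast
qed

text \<open>The hypothesis \<open>gap\<close> is uniform monotonicity of the sum tested against
  \<open>z\<close>, whose own residual is 0. A positive limit of the distances would keep the gap
  above a constant and make \<open>lam\<close> summable.\<close>

lemma strongly_convergent:
  assumes z: "z \<in> zer"
    and \<phi>_mono: "mono_on {0..} \<phi>" and \<phi>_pos: "\<And>t. 0 < t \<Longrightarrow> (0 :: ereal) < \<phi> t"
    and gap: "\<And>n \<omega>. \<omega> \<in> space M \<Longrightarrow>
      \<phi> (norm (y n \<omega> - z)) \<le> ereal (inner (y n \<omega> - z) (u n \<omega> + B (y n \<omega>)))"
    and lam2: "summable (\<lambda>n. (lam n)\<^sup>2)" and lam1: "\<not> summable lam"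
    and r_sum: "AE \<omega> in M. summable (\<lambda>n. (lam n)\<^sup>2 * (norm (r n \<omega> - B (w n \<omega>)))\<^sup>2)"
    and noise_sum: "AE \<omega> in M. (\<Sum>n. ennreal ((lam n)\<^sup>2) * noise n \<omega>) < \<infinity>"
  shows "AE \<omega> in M. (\<lambda>n. x (int n) \<omega>) \<longlonglongrightarrow> z"
proof -
  have "lam \<longlonglongrightarrow> 0"
    using norm_tendsto_0_if_summable_power2[of lam] lam2 by (simp add: tendsto_rabs_zero_iff)
  then have "(\<lambda>n. lam n * L) \<longlonglongrightarrow> 0 * L" by (intro tendsto_intros)
  then have "\<forall>\<^sub>F n in sequentially. lam n * L < 1 / 2"
    by (rule order_tendstoD) simp
  then obtain N where N: "\<And>n. N \<le> n \<Longrightarrow> lam n * L \<le> 1 - 1 / 2"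
    unfolding eventually_sequentially by fastforce
  have "AE \<omega> in M. convergent (\<lambda>n. norm (x (int n) \<omega> - z)) \<and>
    summable (\<lambda>n. (norm (w n \<omega> - y n \<omega>))\<^sup>2) \<and>
    summable (\<lambda>n. lam n * inner (y n \<omega> - z) (u n \<omega> + B (y n \<omega>)))"
    by (rule quasi_fejer[OF z _ _ N r_sum noise_sum]) auto
  with AE_space show ?thesis
  proof eventually_elim
    case (elim \<omega>)
    have \<omega>: "\<omega> \<in> space M" by fact
    let ?g = "\<lambda>n. inner (y n \<omega> - z) (u n \<omega> + B (y n \<omega>))"
    obtain l where l: "(\<lambda>n. norm (x (int n) \<omega> - z)) \<longlonglongrightarrow> l"
      using elim unfolding convergent_def by blast
    have wy: "(\<lambda>n. norm (w n \<omega> - y n \<omega>)) \<longlonglongrightarrow> 0"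
      using elim by (intro norm_tendsto_0_if_summable_power2) blast
    have "l \<le> 0"
    proof (rule ccontr)
      assume "\<not> l \<le> 0"
      then have l0: "0 < l" by simp
      have "\<forall>\<^sub>F n in sequentially. l / 2 < norm (x (int n) \<omega> - z)"
        using l by (rule order_tendstoD) (use l0 in simp)
      moreover have "\<forall>\<^sub>F n in sequentially. norm (w n \<omega> - y n \<omega>) < l / 8"
        using wy by (rule order_tendstoD) (use l0 in simp)
      moreover have "\<forall>\<^sub>F n in sequentially. eps n < l / 8"
        using summable_LIMSEQ_zero[OF eps_summable] by (rule order_tendstoD) (use l0 in simp)
      \<comment> \<open>Passing from \<open>x n\<close> through \<open>w n\<close> to
        \<open>y n\<close> costs less than \<open>l / 8\<close> twice, and
        \<open>l / 2 - l / 8 - l / 8 = l / 4\<close>.\<close>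
      ultimately have far: "\<forall>\<^sub>F n in sequentially. l / 4 \<le> norm (y n \<omega> - z)"
      proof eventually_elim
        case (elim n)
        have "norm (x (int n) \<omega> - z) \<le> norm (x (int n) \<omega> - w n \<omega>) + norm (w n \<omega> - y n \<omega>) + norm (y n \<omega> - z)"
          using norm_triangle_ineq[of "x (int n) \<omega> - w n \<omega>" "w n \<omega> - z"]
            norm_triangle_ineq[of "w n \<omega> - y n \<omega>" "y n \<omega> - z"] by simp
        then show ?case
          using elim norm_w_minus_x[OF \<omega>, of n] by (simp add: norm_minus_commute)
      qed
      have "0 < \<phi> (l / 4)" using l0 by (intro \<phi>_pos) simp
      \<comment> \<open>The modulus may be infinite at \<open>l / 4\<close>, so a positive real
        below it serves as the lower bound for the gap.\<close>
      then obtain c where c: "0 < ereal c" "ereal c < \<phi> (l / 4)"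
        using ereal_dense2 by blast
      have "\<forall>\<^sub>F n in sequentially. norm (c * lam n) \<le> lam n * ?g n"
        using far
      proof eventually_elim
        case (elim n)
        have "\<phi> (l / 4) \<le> \<phi> (norm (y n \<omega> - z))"
          using elim l0 by (intro mono_onD[OF \<phi>_mono]) auto
        then have "ereal c \<le> ereal (?g n)"
          using c(2) gap[OF \<omega>, of n] by (meson less_imp_le order_trans)
        then show ?case using c(1) lam_pos[of n] by (simp add: mult.commute)
      qed
      then have "summable (\<lambda>n. c * lam n)"
        using elim by (intro summable_comparison_test_ev[of "\<lambda>n. c * lam n" "\<lambda>n. lam n * ?g n"]) auto
      then have "summable (\<lambda>n. 1 / c * (c * lam n))" by (rule summable_mult)
      then show False using c(1) lam1 by simp
    qed
    moreover have "0 \<le> l" using l by (rule LIMSEQ_le_const) auto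
    ultimately have "(\<lambda>n. norm (x (int n) \<omega> - z)) \<longlonglongrightarrow> 0" using l by simp
    then show ?case by (simp add: LIM_zero_iff tendsto_norm_zero_iff)
  qed
qed

end

lemma ell_iff:
  assumes "\<And>n. 0 < f n"
  shows "f \<in> ell 2 \<longleftrightarrow> summable (\<lambda>n. (f n)\<^sup>2)" and "f \<in> ell 1 \<longleftrightarrow> summable f"
  using assms by (auto simp: ell_def less_imp_le powr_realpow[of _ 2, simplified])

text \<open>The modulus of whichever operator is uniformly monotone serves the sum too, because the
  other operator contributes a nonnegative inner product.\<close>

lemma uniformly_monotone_op_sum:
  assumes monoA: "monotone_op A" and monoB: "monotone_op (\<lambda>z. {B z})"
    and unif: "uniformly_monotone_op A \<or> uniformly_monotone_op (\<lambda>z. {B z})"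
  obtains \<phi> where "mono_on {0..} \<phi>" "\<And>t. 0 < t \<Longrightarrow> (0 :: ereal) < \<phi> t"
    "\<And>a b v v'. v \<in> A a \<Longrightarrow> v' \<in> A b \<Longrightarrow>
      \<phi> (norm (a - b)) \<le> ereal (inner (a - b) ((v + B a) - (v' + B b)))"
proof -
  have A0: "0 \<le> inner (a - b) (v - v')" if "v \<in> A a" "v' \<in> A b" for a b v v'
    using that monoA unfolding monotone_op_def by blast
  have B0: "0 \<le> inner (a - b) (B a - B b)" for a b
    using monoB unfolding monotone_op_def by simp
  have eq: "inner (a - b) ((v + B a) - (v' + B b)) = inner (a - b) (v - v') + inner (a - b) (B a - B b)" for a b v v'
    by (simp add: inner_add_right inner_diff_right)
  from unif obtain \<phi> :: "real \<Rightarrow> ereal" where \<phi>: "mono_on {0..} \<phi>" "\<forall>t\<ge>0. 0 \<le> \<phi> t"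
      "\<forall>t\<ge>0. \<phi> t = 0 \<longleftrightarrow> t = 0"
    and "(\<forall>a b. \<forall>v\<in>A a. \<forall>v'\<in>A b. \<phi> (norm (b - a)) \<le> ereal (inner (a - b) (v - v'))) \<or>
      (\<forall>a b. \<phi> (norm (b - a)) \<le> ereal (inner (a - b) (B a - B b)))"
    unfolding uniformly_monotone_op_def by auto
  then have "\<phi> (norm (a - b)) \<le> ereal (inner (a - b) ((v + B a) - (v' + B b)))"
    if "v \<in> A a" "v' \<in> A b" for a b v v'
  proof -
    have "ereal (inner (a - b) (v - v')) \<le> ereal (inner (a - b) ((v + B a) - (v' + B b)))"
      "ereal (inner (a - b) (B a - B b)) \<le> ereal (inner (a - b) ((v + B a) - (v' + B b)))"
      using A0[OF that] B0[of a b] unfolding eq by simp_all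
    moreover have "\<phi> (norm (b - a)) \<le> ereal (inner (a - b) (v - v')) \<or>
        \<phi> (norm (b - a)) \<le> ereal (inner (a - b) (B a - B b))"
      using \<open>(\<forall>a b. \<forall>v\<in>A a. \<forall>v'\<in>A b. _ a b v v') \<or> _\<close> that by blast
    ultimately show ?thesis
      unfolding norm_minus_commute[of a b] by (meson order_trans)
  qed
  moreover have "0 < \<phi> t" if "0 < t" for t
  proof -
    have "0 \<le> \<phi> t" "\<phi> t \<noteq> 0" using \<phi>(2,3) that by auto
    then show ?thesis by simp
  qed
  ultimately show thesis using that \<phi>(1) by blast
qed

theorem theorem3p5:
  fixes M :: "'w measure"
    and A :: "'a::{real_inner, banach, second_countable_topology} \<Rightarrow> 'a set"
    and B :: "'a \<Rightarrow> 'a"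
    and L \<theta> :: real
    and lam eps :: "nat \<Rightarrow> real"
    and x :: "int \<Rightarrow> 'w \<Rightarrow> 'a"
    and w y r s :: "nat \<Rightarrow> 'w \<Rightarrow> 'a"
  assumes "prob_space M"
    and "maximally_monotone_op A"
    and "monotone_op (\<lambda>z. {B z})"
    and "L > 0" and "L-lipschitz_on UNIV B"
    and "op_inv (op_add A (\<lambda>z. {B z})) 0 \<noteq> {}"
    and "0 \<le> \<theta>" and "\<theta> \<le> 1"
    and "\<And>n. lam n > 0"
    and "\<And>n. eps n \<ge> 0" and "summable eps"
    and "sfbf M A B \<theta> eps lam x w y r s"
  shows
    "((\<exists>\<epsilon>>0. \<forall>n. lam n \<in> {\<epsilon><..<(1 - \<epsilon>) / L}) \<and>
      (AE \<omega> in M. (\<Sum>n. nn_cond_exp M (history M x r n)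
           (\<lambda>\<omega>. ennreal ((norm (s n \<omega> - B (y n \<omega>)))\<^sup>2)) \<omega>) < \<infinity>) \<and>
      (AE \<omega> in M. summable (\<lambda>n. (norm (r n \<omega> - B (w n \<omega>)))\<^sup>2))
      \<longrightarrow> (\<exists>xbar \<in> borel_measurable M.
             (\<forall>\<omega>\<in>space M. xbar \<omega> \<in> op_inv (op_add A (\<lambda>z. {B z})) 0) \<and>
             (AE \<omega> in M. weakly_converges (\<lambda>n. x (int n) \<omega>) (xbar \<omega>))))
   \<and> ((uniformly_monotone_op A \<or> uniformly_monotone_op (\<lambda>z. {B z})) \<and>
      lam \<in> ell 2 - ell 1 \<and>
      (AE \<omega> in M. summable (\<lambda>n. (lam n)\<^sup>2 * (norm (r n \<omega> - B (w n \<omega>)))\<^sup>2)) \<and>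
      (AE \<omega> in M. (\<Sum>n. ennreal ((lam n)\<^sup>2) * nn_cond_exp M (history M x r n)
           (\<lambda>\<omega>. ennreal ((norm (s n \<omega> - B (y n \<omega>)))\<^sup>2)) \<omega>) < \<infinity>)
      \<longrightarrow> (\<exists>xbar. op_inv (op_add A (\<lambda>z. {B z})) 0 = {xbar} \<and>
             (AE \<omega> in M. (\<lambda>n. x (int n) \<omega>) \<longlonglongrightarrow> xbar)))"
proof -
  interpret prob_space M by fact
  interpret stochastic_fbf M A B L \<theta> lam eps x w y r s
    by unfold_locales (use assms in auto)
  have zer_eq: "op_inv (op_add A (\<lambda>z. {B z})) 0 = zer"
    by (auto simp: zeros_iff zer_def)
  then have ne: "zer \<noteq> {}" using assms(6) by simp
  show ?thesis
    unfolding zer_eq noise_def[symmetric]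
  proof (intro conjI impI; elim conjE)
    assume "\<exists>\<epsilon>>0. \<forall>n. lam n \<in> {\<epsilon><..<(1 - \<epsilon>) / L}"
      and *: "AE \<omega> in M. (\<Sum>n. noise n \<omega>) < \<infinity>"
        "AE \<omega> in M. summable (\<lambda>n. (norm (r n \<omega> - B (w n \<omega>)))\<^sup>2)"
    then obtain \<epsilon> where "0 < \<epsilon>" "\<And>n. lam n \<in> {\<epsilon><..<(1 - \<epsilon>) / L}" by blast
    from weakly_convergent[OF ne this *]
    show "\<exists>xbar \<in> borel_measurable M. (\<forall>\<omega>\<in>space M. xbar \<omega> \<in> zer) \<and>
      (AE \<omega> in M. weakly_converges (\<lambda>n. x (int n) \<omega>) (xbar \<omega>))" .
  next
    assume unif: "uniformly_monotone_op A \<or> uniformly_monotone_op (\<lambda>z. {B z})"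
      and lam: "lam \<in> ell 2 - ell 1"
      and *: "AE \<omega> in M. summable (\<lambda>n. (lam n)\<^sup>2 * (norm (r n \<omega> - B (w n \<omega>)))\<^sup>2)"
        "AE \<omega> in M. (\<Sum>n. ennreal ((lam n)\<^sup>2) * noise n \<omega>) < \<infinity>"
    obtain \<phi> where \<phi>: "mono_on {0..} \<phi>" "\<And>t. 0 < t \<Longrightarrow> (0 :: ereal) < \<phi> t"
      and gap: "\<And>a b v v'. v \<in> A a \<Longrightarrow> v' \<in> A b \<Longrightarrow>
        \<phi> (norm (a - b)) \<le> ereal (inner (a - b) ((v + B a) - (v' + B b)))"
      using uniformly_monotone_op_sum[OF monotone_A monotone_B unif] by metis
    obtain z where z: "z \<in> zer" using ne by blast
    \<comment> \<open>At two zeros both residuals \<open>v + B a\<close> vanish, so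
      \<open>gap\<close> bounds the modulus of their distance by 0.\<close>
    have "z' = z" if "z' \<in> zer" for z'
    proof (rule ccontr)
      assume "z' \<noteq> z"
      then have "0 < \<phi> (norm (z' - z))" by (intro \<phi>(2)) simp
      moreover have "\<phi> (norm (z' - z)) \<le> 0"
        using gap[of "- B z'" z' "- B z" z] z that by (simp add: zer_def zero_ereal_def)
      ultimately show False by simp
    qed
    then have "zer = {z}" using z by blast
    moreover have "AE \<omega> in M. (\<lambda>n. x (int n) \<omega>) \<longlonglongrightarrow> z"
    proof (rule strongly_convergent[OF z \<phi>])
      show "\<phi> (norm (y n \<omega> - z)) \<le> ereal (inner (y n \<omega> - z) (u n \<omega> + B (y n \<omega>)))"
        if "\<omega> \<in> space M" for n \<omega>
        using gap[OF u_mem[OF that, of n], of "- B z" z] z by (simp add: zer_def)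
    qed (use lam * ell_iff[OF lam_pos] in auto)
    ultimately show "\<exists>xbar. zer = {xbar} \<and> (AE \<omega> in M. (\<lambda>n. x (int n) \<omega>) \<longlonglongrightarrow> xbar)" by blast
  qed
qed

end
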